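(* Let $\mathfrak{M}$ be a non-quasianalytic weight matrix of R-moderate growth and consider $\mathfrak{K}=\mathfrak{K}(\mathfrak{M})$ and $\mathfrak{Q}=\mathfrak{Q}(\mathfrak{M})$. Then $\Lambda^{\{\mathfrak{K}\}}=\Lambda^{\{\mathfrak{Q}\}}\subseteq j^\infty\mathcal{E}^{\{\mathfrak{M}\}}(\mathbb{R})$.
   Context: A weight sequence is $M=(M_k)_{k\ge0}$ with $M_k=\mu_0\cdots\mu_k$, $1=\mu_0\le\mu_1\le\cdots$, $\mu_k\to\infty$; non-quasianalytic if $\sum1/\mu_k<\infty$. A weight matrix $\mathfrak{M}=\{M^{(\alpha)}:\alpha>0\}$ is a family of weight sequences with $M^{(\alpha)}\le M^{(\beta)}$ for $\alpha\le\beta$; non-quasianalytic if all members are; R-moderate growth: for every $M\in\mathfrak{M}$ there exist $N\in\mathfrak{M}$, $C\ge1$ with $M_{j+k}\le C^{j+k}N_jN_k$ for all $j,k$. Spaces: $\Lambda^{\{M\}}=\{a\in\mathbb{C}^{\mathbb{N}}:\exists\sigma>0,\sup_k|a_k|/(\sigma^kM_k)<\infty\}$, $\Lambda^{\{\mathfrak{F}\}}=\bigcup_{M\in\mathfrak{F}}\Lambda^{\{M\}}$ for a family $\mathfrak{F}$ of positive sequences; $\mathcal{E}^{\{\mathfrak{M}\}}(\mathbb{R})$ is the set of $f\in C^\infty(\mathbb{R})$ such that for each $n$ there are $\sigma>0$, $M\in\mathfrak{M}$ with $\sup_{x\in[-n,n],k}|f^{(k)}(x)|/(\sigma^kM_k)<\infty$;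 $j^\infty f=(f^{(k)}(0))_k$. $\omega_M(t)=\sup_k\log(t^kM_0/M_k)$, $\widetilde\omega_M=\omega_M+\log(1+t^2)$; for a non-quasianalytic pre-weight function $\omega$: $\kappa_\omega(t)=\int_1^\infty\omega(ts)s^{-2}ds$, $\varphi^*_\omega(x)=\sup_{y\ge0}(xy-\omega(e^y))$, $P_\omega(x+iy)=\frac{|y|}{\pi}\int_{\mathbb{R}}\frac{\omega(|t|)}{(x-t)^2+y^2}dt$ ($y\ne0$). Derived: $\kappa_\alpha=\kappa_{\widetilde\omega_{M^{(\alpha)}}}$, $K^{(\alpha)}_j=\exp(\varphi^*_{\kappa_\alpha}(j))$ with $\kappa_\alpha$ replaced by an equivalent normalized function (vanishing on $[0,1]$); $Q^{(\alpha)}_k=\sup_{r>0}r^{k+1/2}\exp(-\frac12P_{\widetilde\omega_{M^{(\alpha)}}}(ir))$; $\mathfrak{K}=\{K^{(\alpha)}\}$, $\mathfrak{Q}=\{Q^{(\alpha)}\}$. *)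

theory Defs
  imports "HOL-Analysis.Analysis"
begin

definition weight_seq :: "(nat \<Rightarrow> real) \<Rightarrow> bool" where
  "weight_seq M \<longleftrightarrow> (\<exists>\<mu> :: nat \<Rightarrow> real. \<mu> 0 = 1 \<and> mono \<mu> \<and> filterlim \<mu> at_top sequentially
      \<and> (\<forall>k. M k = (\<Prod>i\<le>k. \<mu> i)))"

definition mu_of :: "(nat \<Rightarrow> real) \<Rightarrow> nat \<Rightarrow> real" where
  "mu_of M k = (if k = 0 then M 0 else M k / M (k - 1))"

definition nonquasianalytic_seq :: "(nat \<Rightarrow> real) \<Rightarrow> bool" where
  "nonquasianalytic_seq M \<longleftrightarrow> summable (\<lambda>k. 1 / mu_of M k)"

definition weight_matrix :: "(real \<Rightarrow> nat \<Rightarrow> real) \<Rightarrow> bool" where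
  "weight_matrix MM \<longleftrightarrow> (\<forall>\<alpha>>0. weight_seq (MM \<alpha>))
     \<and> (\<forall>\<alpha> \<beta>. 0 < \<alpha> \<longrightarrow> \<alpha> \<le> \<beta> \<longrightarrow> (\<forall>k. MM \<alpha> k \<le> MM \<beta> k))"

definition nonquasianalytic_matrix :: "(real \<Rightarrow> nat \<Rightarrow> real) \<Rightarrow> bool" where
  "nonquasianalytic_matrix MM \<longleftrightarrow> (\<forall>\<alpha>>0. nonquasianalytic_seq (MM \<alpha>))"

definition R_moderate_growth :: "(real \<Rightarrow> nat \<Rightarrow> real) \<Rightarrow> bool" where
  "R_moderate_growth MM \<longleftrightarrow> (\<forall>\<alpha>>0. \<exists>\<beta>>0. \<exists>C\<ge>1. \<forall>j k.
      MM \<alpha> (j + k) \<le> C ^ (j + k) * MM \<beta> j * MM \<beta> k)"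

definition Lambda_seq :: "(nat \<Rightarrow> real) \<Rightarrow> (nat \<Rightarrow> complex) set" where
  "Lambda_seq M = {a. \<exists>\<sigma>>0. bdd_above (range (\<lambda>k. norm (a k) / (\<sigma> ^ k * M k)))}"

definition Lambda_fam :: "(real \<Rightarrow> nat \<Rightarrow> real) \<Rightarrow> (nat \<Rightarrow> complex) set" where
  "Lambda_fam F = (\<Union>\<alpha>\<in>{0<..}. Lambda_seq (F \<alpha>))"

definition deriv_tower :: "(real \<Rightarrow> complex) \<Rightarrow> (nat \<Rightarrow> real \<Rightarrow> complex) \<Rightarrow> bool" where
  "deriv_tower f D \<longleftrightarrow> D 0 = f \<and> (\<forall>k x. (D k has_vector_derivative D (Suc k) x) (at x))"

definition E_roumieu :: "(real \<Rightarrow> nat \<Rightarrow> real) \<Rightarrow> (real \<Rightarrow> complex) set" where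
  "E_roumieu MM = {f. \<exists>D. deriv_tower f D \<and>
      (\<forall>n::nat. \<exists>\<sigma>>0. \<exists>\<alpha>>0. bdd_above
          ((\<lambda>(x, k). norm (D k x) / (\<sigma> ^ k * MM \<alpha> k)) ` ({- real n .. real n} \<times> UNIV)))}"

definition jet_image :: "(real \<Rightarrow> nat \<Rightarrow> real) \<Rightarrow> (nat \<Rightarrow> complex) set" where
  "jet_image MM = {(\<lambda>k. D k 0) | f D. f \<in> E_roumieu MM \<and> deriv_tower f D}"

definition omega_M :: "(nat \<Rightarrow> real) \<Rightarrow> real \<Rightarrow> real" where
  "omega_M M t = (SUP k. ln (t ^ k * M 0 / M k))"

definition omega_tilde :: "(nat \<Rightarrow> real) \<Rightarrow> real \<Rightarrow> real" where
  "omega_tilde M t = omega_M M t + ln (1 + t\<^sup>2)"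

definition kappa :: "(real \<Rightarrow> real) \<Rightarrow> real \<Rightarrow> real" where
  "kappa \<omega> t = integral {1..} (\<lambda>s. \<omega> (t * s) / s\<^sup>2)"

definition phi_star :: "(real \<Rightarrow> real) \<Rightarrow> real \<Rightarrow> real" where
  "phi_star \<omega> x = (SUP y\<in>{0..}. x * y - \<omega> (exp y))"

definition poisson :: "(real \<Rightarrow> real) \<Rightarrow> complex \<Rightarrow> real" where
  "poisson \<omega> z = \<bar>Im z\<bar> / pi * integral UNIV (\<lambda>t. \<omega> \<bar>t\<bar> / ((Re z - t)\<^sup>2 + (Im z)\<^sup>2))"

definition K_seq :: "(real \<Rightarrow> real) \<Rightarrow> nat \<Rightarrow> real" where
  "K_seq \<kappa> j = exp (phi_star \<kappa> (real j))"

definition Q_seq :: "(nat \<Rightarrow> real) \<Rightarrow> nat \<Rightarrow> real" where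
  "Q_seq M k = (SUP r\<in>{0<..}. r powr (real k + 1 / 2)
        * exp (- (1 / 2) * poisson (omega_tilde M) (\<i> * complex_of_real r)))"

end

theory Submission
  imports Defs
begin

text \<open>
  Write \<open>M k = m 0 * \<dots> * m (k - 1)\<close>. Then \<open>omega t = (\<Sum>i. ln (max 1 (t / m i)))\<close>, and the
  function \<open>kappa0\<close> belonging to \<open>omega\<close> is \<open>omega + psi\<close> with \<open>psi t = (\<Sum>i. min 1 (t / m i))\<close>. It is
  convex in \<open>ln t\<close> with derivative \<open>psi\<close>, so if \<open>psi r = k\<close>, then \<open>t ^ k * exp (- kappa0 t)\<close> is maximal
  at \<open>t = r\<close>, with value \<open>r ^ k * exp (- omega r - k)\<close>.

  For this \<open>r\<close>, averaging a trapezoid over intervals of half-lengths \<open>1 / max r (m i)\<close>, which add up to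
  \<open>k / r\<close>, produces a cutoff \<open>\<chi>\<close> equal to 1 near 0. By Leibniz' rule the \<open>j\<close>-th derivative of
  \<open>x ^ k / fact k * \<chi> x\<close> is at most \<open>2 ^ j * M j * (3 * exp 1) ^ k * exp (omega r) / r ^ k\<close>, which is
  \<open>2 ^ j * 3 ^ k * M j\<close> divided by the above maximum. Suitably dilated, these functions can be summed
  against any sequence in \<open>\<Lambda>\<close> of \<open>K\<close>, which proves the inclusion without changing the weight.

  The equality follows from \<open>kappa1 r \<le> pi * P (i r) \<le> 4 * kappa1 r\<close>, where \<open>kappa1\<close> belongs to
  \<open>omega_tilde\<close>; moderate growth gives \<open>2 * omega_N t \<le> omega_M (C * t)\<close>, which absorbs the constants.
\<close>

section \<open>Cutoff functions from iterated averages\<close>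

text \<open>The mean of \<open>u\<close> over the interval of half-length \<open>a\<close> around
  \<open>x\<close>. Parametrizing by \<open>{0..1}\<close> keeps the domain of integration
  independent of \<open>x\<close> and \<open>a\<close>.\<close>

definition average :: "real \<Rightarrow> (real \<Rightarrow> real) \<Rightarrow> real \<Rightarrow> real" where
  "average a u x = integral {0..1} (\<lambda>s. u (x + a * (2 * s - 1)))"

lemma lipschitz_imp_continuous_on:
  fixes u :: "real \<Rightarrow> real"
  assumes "\<And>x y. \<bar>u x - u y\<bar> \<le> L * \<bar>x - y\<bar>"
  shows "continuous_on S u"
proof -
  have "(\<bar>L\<bar>)-lipschitz_on UNIV u"
    by (rule lipschitz_onI)
      (use assms in \<open>auto simp: dist_real_def intro: order_trans[OF assms mult_right_mono]\<close>)
  then show ?thesis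
    using lipschitz_on_continuous_on continuous_on_subset by blast
qed

lemma average_integrable:
  fixes u :: "real \<Rightarrow> real"
  assumes "continuous_on UNIV u"
  shows "(\<lambda>s. u (x + a * (2 * s - 1))) integrable_on {0..1}"
  by (intro integrable_continuous_real continuous_intros continuous_on_compose2[OF assms]) auto

lemma average_cong_ball:
  assumes "0 \<le> a" and "\<And>y. \<bar>y - x\<bar> \<le> a \<Longrightarrow> u y = c"
  shows "average a u x = c"
proof -
  have *: "\<bar>x + a * (2 * s - 1) - x\<bar> \<le> a" if "s \<in> {0..1}" for s
    using that assms(1) mult_left_le[of "\<bar>2 * s - 1\<bar>" a] by (auto simp: abs_mult)
  have "average a u x = integral {0..1} (\<lambda>s::real. c)"
    unfolding average_def by (rule integral_cong) (use * assms(2) in blast)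
  then show ?thesis by simp
qed

text \<open>Two functions and two points are allowed at once, so that this one estimate yields the
  Lipschitz bound, the supremum bound (by comparison with the constant 0) and the convergence rate
  of iterated averages.\<close>

lemma average_diff_le:
  assumes "continuous_on UNIV u" "continuous_on UNIV v" "0 \<le> a"
    and "\<And>s. \<bar>s\<bar> \<le> a \<Longrightarrow> \<bar>u (x + s) - v (y + s)\<bar> \<le> B"
  shows "\<bar>average a u x - average a v y\<bar> \<le> B"
proof -
  have *: "\<bar>a * (2 * s - 1)\<bar> \<le> a" if "s \<in> {0..1}" for s
    using that assms(3) mult_left_le[of "\<bar>2 * s - 1\<bar>" a] by (auto simp: abs_mult)
  have "average a u x - average a v y
      = integral {0..1} (\<lambda>s. u (x + a * (2 * s - 1)) - v (y + a * (2 * s - 1)))"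
    unfolding average_def
    by (rule integral_diff[symmetric]) (intro average_integrable assms)+
  also have "norm \<dots> \<le> integral {0..1} (\<lambda>s::real. B)"
    using * assms(4)
    by (intro integral_norm_bound_integral integrable_diff average_integrable assms(1,2)) auto
  finally show ?thesis by simp
qed

lemma average_const: "average a (\<lambda>_. c) x = c"
  by (simp add: average_def)

lemma average_has_derivative:
  assumes u: "continuous_on UNIV u" and a: "0 < a"
  shows "(average a u has_real_derivative (u (x + a) - u (x - a)) / (2 * a)) (at x)"
proof -
  \<comment> \<open>The margin 1 beyond \<open>x - a\<close> and \<open>x + a\<close> makes the
    formula for the average by the antiderivative \<open>U\<close> valid on a whole neighbourhood of
    \<open>x\<close>.\<close>
  define U where "U y = integral {x - a - 1..y} u" for y
  have U: "(U has_real_derivative u y) (at y within {x - a - 1..x + a + 1})"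
    if "y \<in> {x - a - 1..x + a + 1}" for y
    unfolding U_def using that
    by (intro integral_has_real_derivative continuous_on_subset[OF u]) auto
  have U': "(U has_real_derivative u y) (at y)" if "y \<in> {x - a - 1<..<x + a + 1}" for y
    using U[of y] that at_within_Icc_at[of "x - a - 1" y "x + a + 1"] by auto
  have avg: "average a u y = (U (y + a) - U (y - a)) / (2 * a)" if "y \<in> {x - 1<..<x + 1}" for y
  proof -
    have in_range: "y + a * (2 * s - 1) \<in> {x - a - 1<..<x + a + 1}" if "s \<in> {0..1}" for s
    proof -
      have "\<bar>a * (2 * s - 1)\<bar> \<le> a"
        using that a mult_left_le[of "\<bar>2 * s - 1\<bar>" a] by (auto simp: abs_mult)
      then show ?thesis using \<open>y \<in> _\<close> by auto
    qed
    have "((\<lambda>s. U (y + a * (2 * s - 1)) / (2 * a)) has_real_derivative u (y + a * (2 * s - 1)))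
        (at s within {0..1})" if "s \<in> {0..1}" for s
    proof -
      have "((\<lambda>s. U (y + a * (2 * s - 1))) has_real_derivative u (y + a * (2 * s - 1)) * (2 * a))
          (at s within {0..1})"
        by (rule DERIV_chain2[where f = U, OF U'])
          (use in_range[OF that] in \<open>auto intro!: derivative_eq_intros\<close>)
      from DERIV_cdivide[OF this, of "2 * a"] show ?thesis
        using a by simp
    qed
    then have "((\<lambda>s. u (y + a * (2 * s - 1))) has_integral
        U (y + a * (2 * 1 - 1)) / (2 * a) - U (y + a * (2 * 0 - 1)) / (2 * a)) {0..1}"
      by (intro fundamental_theorem_of_calculus)
        (auto simp: has_real_derivative_iff_has_vector_derivative)
    then show ?thesis
      unfolding average_def by (auto simp: diff_divide_distrib dest: integral_unique)
  qed
  have "((\<lambda>y. (U (y + a) - U (y - a)) / (2 * a)) has_real_derivative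
      (u (x + a) - u (x - a)) / (2 * a)) (at x)"
    using a by (auto intro!: derivative_eq_intros DERIV_chain2[OF U'] simp: field_simps)
  then show ?thesis
    by (rule has_field_derivative_transform_within_open[where S = "{x - 1<..<x + 1}"])
      (auto simp: avg)
qed

text \<open>The half-lengths are \<open>a m\<close>, ..., \<open>a (m + n - 1)\<close>, the first
  one outermost. Differentiation removes the outermost average, which is why the starting index
  \<open>m\<close> is a parameter.\<close>

fun iterated_average :: "(nat \<Rightarrow> real) \<Rightarrow> (real \<Rightarrow> real) \<Rightarrow> nat \<Rightarrow> nat \<Rightarrow> real \<Rightarrow> real" where
  "iterated_average a u 0 m = u"
| "iterated_average a u (Suc n) m = average (a m) (iterated_average a u n (Suc m))"

text \<open>The derivatives of a system of functions with \<open>v m = average (a m) (v (Suc m))\<close> are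
  difference quotients of later members of the system.\<close>

fun difference_tower :: "(nat \<Rightarrow> real) \<Rightarrow> (nat \<Rightarrow> real \<Rightarrow> real) \<Rightarrow> nat \<Rightarrow> nat \<Rightarrow> real \<Rightarrow> real" where
  "difference_tower a v 0 m = v m"
| "difference_tower a v (Suc j) m = (\<lambda>x.
    (difference_tower a v j (Suc m) (x + a m) - difference_tower a v j (Suc m) (x - a m)) / (2 * a m))"

lemma difference_tower_has_derivative:
  assumes "\<And>m x. (v m has_real_derivative (v (Suc m) (x + a m) - v (Suc m) (x - a m)) / (2 * a m)) (at x)"
  shows "(difference_tower a v j m has_real_derivative difference_tower a v (Suc j) m x) (at x)"
proof (induction j arbitrary: m x)
  case 0
  then show ?case using assms by simp
next
  case (Suc j)
  have "((\<lambda>x. difference_tower a v j (Suc m) (x + e)) has_real_derivative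
      difference_tower a v (Suc j) (Suc m) (x + e)) (at x)" for e
    using Suc DERIV_shift by blast
  from this[of "a m"] this[of "- a m"] show ?case
    unfolding difference_tower.simps(2)[of a v j m] difference_tower.simps(2)[of a v "Suc j" m]
    by (intro DERIV_cdivide DERIV_diff) (simp_all del: difference_tower.simps)
qed

text \<open>Each difference at most doubles the supremum and is divided by \<open>2 * a m\<close>,
  so the factors 2 cancel.\<close>

lemma difference_tower_bound:
  assumes "\<And>m. 0 < a m" "\<And>m x. \<bar>v m x\<bar> \<le> 1"
  shows "\<bar>difference_tower a v j m x\<bar> \<le> (\<Prod>i<j. 1 / a (m + i))"
proof (induction j arbitrary: m x)
  case 0
  then show ?case using assms by simp
next
  case (Suc j)
  let ?B = "\<Prod>i<j. 1 / a (Suc m + i)"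
  have "\<bar>difference_tower a v j (Suc m) (x + a m) - difference_tower a v j (Suc m) (x - a m)\<bar> \<le> ?B + ?B"
    using Suc[of "Suc m" "x + a m"] Suc[of "Suc m" "x - a m"] by linarith
  then have "\<bar>difference_tower a v (Suc j) m x\<bar> \<le> (?B + ?B) / (2 * a m)"
    unfolding difference_tower.simps abs_divide using assms(1)[of m]
    by (intro frac_le) auto
  also have "\<dots> = (\<Prod>i<Suc j. 1 / a (m + i))"
    using assms(1)[of m] by (subst prod.lessThan_Suc_shift) (simp add: field_simps)
  finally show ?case .
qed

text \<open>\<open>R m\<close> is the radius within which \<open>u\<close> determines
  \<open>v m x\<close>. A difference quotient moves the point by \<open>a m\<close> but passes to
  index \<open>Suc m\<close>, whose radius is smaller by exactly \<open>a m\<close>; where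
  \<open>u\<close> is constant, the differences therefore cancel.\<close>

lemma difference_tower_locally_constant:
  assumes v: "\<And>m x. (\<And>y. \<bar>y - x\<bar> \<le> R m \<Longrightarrow> u y = c) \<Longrightarrow> v m x = c"
    and R: "\<And>m. R m = a m + R (Suc m)" and a: "\<And>m. 0 < a m"
    and const: "\<And>y. \<bar>y - x\<bar> \<le> R m \<Longrightarrow> u y = c"
  shows "difference_tower a v j m x = (if j = 0 then c else 0)"
  using const
proof (induction j arbitrary: m x)
  case 0
  then show ?case using v by simp
next
  case (Suc j)
  have "difference_tower a v j (Suc m) (x + e) = (if j = 0 then c else 0)" if "\<bar>e\<bar> = a m" for e
    by (rule Suc.IH, rule Suc.prems) (use that R[of m] in linarith)
  from this[of "a m"] this[of "- a m"] show ?case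
    using a[of m] by simp
qed

section \<open>Infinitely iterated averages of a bounded Lipschitz function\<close>

context
  fixes a :: "nat \<Rightarrow> real" and u :: "real \<Rightarrow> real" and L :: real
  assumes a: "\<And>i. 0 < a i" and a_summable: "summable a"
    and u_bound: "\<And>x. \<bar>u x\<bar> \<le> 1" and u_lipschitz: "\<And>x y. \<bar>u x - u y\<bar> \<le> L * \<bar>x - y\<bar>"
begin

lemma iterated_average_lipschitz:
  "\<bar>iterated_average a u n m x - iterated_average a u n m y\<bar> \<le> L * \<bar>x - y\<bar>"
proof (induction n arbitrary: m x y)
  case (Suc n)
  have "continuous_on UNIV (iterated_average a u n (Suc m))"
    by (rule lipschitz_imp_continuous_on[OF Suc])
  then show ?case
    unfolding iterated_average.simps
  proof (intro average_diff_le)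
    show "\<bar>iterated_average a u n (Suc m) (x + s) - iterated_average a u n (Suc m) (y + s)\<bar>
        \<le> L * \<bar>x - y\<bar>" for s
      using Suc[of "Suc m" "x + s" "y + s"] by simp
  qed (use a[of m] in auto)
qed (simp add: u_lipschitz)

lemma iterated_average_continuous: "continuous_on S (iterated_average a u n m)"
  by (rule lipschitz_imp_continuous_on[OF iterated_average_lipschitz])

lemma iterated_average_bound: "\<bar>iterated_average a u n m x\<bar> \<le> 1"
proof (induction n arbitrary: m x)
  case (Suc n)
  have "\<bar>average (a m) (iterated_average a u n (Suc m)) x - average (a m) (\<lambda>_. 0) x\<bar> \<le> 1"
    by (rule average_diff_le) (use Suc a[of m] in \<open>auto intro: iterated_average_continuous less_imp_le\<close>)
  then show ?case by (simp add: average_const)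
qed (simp add: u_bound)

text \<open>Passing from \<open>n\<close> to \<open>Suc n\<close> inserts a new innermost average,
  which changes \<open>u\<close> by at most \<open>L * a (n + m)\<close>; the outer averages
  preserve this bound.\<close>

lemma iterated_average_step:
  "\<bar>iterated_average a u (Suc n) m x - iterated_average a u n m x\<bar> \<le> L * a (n + m)"
proof (induction n arbitrary: m x)
  case 0
  have L: "0 \<le> L" using u_lipschitz[of 1 0] by simp
  have "\<bar>average (a m) u x - average (a m) (\<lambda>_. u x) x\<bar> \<le> L * a m"
  proof (rule average_diff_le)
    fix s assume "\<bar>s\<bar> \<le> a m"
    then show "\<bar>u (x + s) - u x\<bar> \<le> L * a m"
      using u_lipschitz[of "x + s" x] mult_left_mono[OF _ L, of "\<bar>s\<bar>" "a m"] by simp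
  qed (use a[of m] lipschitz_imp_continuous_on[OF u_lipschitz] in auto)
  then show ?case by (simp add: average_const)
next
  case (Suc n)
  have "\<bar>average (a m) (iterated_average a u (Suc n) (Suc m)) x
      - average (a m) (iterated_average a u n (Suc m)) x\<bar> \<le> L * a (n + Suc m)"
    by (rule average_diff_le)
      (use Suc[of "Suc m"] a[of m] iterated_average_continuous in \<open>auto simp del: iterated_average.simps\<close>)
  then show ?case by simp
qed

definition limit_average :: "nat \<Rightarrow> real \<Rightarrow> real" where
  "limit_average m x = lim (\<lambda>n. iterated_average a u n m x)"

lemma limit_average_LIMSEQ: "(\<lambda>n. iterated_average a u n m x) \<longlonglongrightarrow> limit_average m x"
proof -
  have "summable (\<lambda>n. L * a (n + m))"
    using a_summable by (intro summable_mult) (simp add: summable_iff_shift)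
  then have "summable (\<lambda>n. iterated_average a u (Suc n) m x - iterated_average a u n m x)"
    by (rule summable_comparison_test') (use iterated_average_step in \<open>auto simp del: iterated_average.simps\<close>)
  then have "convergent (\<lambda>n. \<Sum>i<n. iterated_average a u (Suc i) m x - iterated_average a u i m x)"
    by (simp add: summable_iff_convergent)
  then have "convergent (\<lambda>n. iterated_average a u n m x - u x)"
    by (subst (asm) sum_lessThan_telescope) simp
  then have "convergent (\<lambda>n. iterated_average a u n m x)"
    using convergent_diff_const_right_iff by blast
  then show ?thesis
    unfolding limit_average_def by (simp add: convergent_LIMSEQ_iff)
qed

lemma limit_average_lipschitz: "\<bar>limit_average m x - limit_average m y\<bar> \<le> L * \<bar>x - y\<bar>"
  by (rule LIMSEQ_le_const2[OF tendsto_rabs[OF tendsto_diff[OF limit_average_LIMSEQ limit_average_LIMSEQ]]])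
    (use iterated_average_lipschitz in auto)

lemma limit_average_bound: "\<bar>limit_average m x\<bar> \<le> 1"
  by (rule LIMSEQ_le_const2[OF tendsto_rabs[OF limit_average_LIMSEQ]])
    (use iterated_average_bound in auto)

text \<open>Dominated convergence with bound 1 passes the limit through the outermost average. This
  relation makes the limit smooth, since it can be differentiated again and again.\<close>

lemma limit_average_eq: "limit_average m x = average (a m) (limit_average (Suc m)) x"
proof -
  have "(\<lambda>n. integral {0..1} (\<lambda>s. iterated_average a u n (Suc m) (x + a m * (2 * s - 1))))
     \<longlonglongrightarrow> integral {0..1} (\<lambda>s. limit_average (Suc m) (x + a m * (2 * s - 1)))"
  proof (rule dominated_convergence(2))
    show "(\<lambda>s. 1) integrable_on {0..1::real}" by auto
  qed (use iterated_average_bound limit_average_LIMSEQ in 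
      \<open>auto intro!: average_integrable iterated_average_continuous\<close>)
  then have "(\<lambda>n. iterated_average a u (Suc n) m x) \<longlonglongrightarrow> average (a m) (limit_average (Suc m)) x"
    by (simp add: average_def)
  then show ?thesis
    using LIMSEQ_Suc[OF limit_average_LIMSEQ] LIMSEQ_unique by blast
qed

lemma limit_average_has_derivative:
  "(limit_average m has_real_derivative
     (limit_average (Suc m) (x + a m) - limit_average (Suc m) (x - a m)) / (2 * a m)) (at x)"
proof -
  have "limit_average m = average (a m) (limit_average (Suc m))"
    using limit_average_eq by blast
  then show ?thesis
    using average_has_derivative[OF lipschitz_imp_continuous_on[OF limit_average_lipschitz] a]
    by metis
qed

lemma iterated_average_locally_constant:
  assumes "\<And>y. \<bar>y - x\<bar> \<le> (\<Sum>i<n. a (m + i)) \<Longrightarrow> u y = c"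
  shows "iterated_average a u n m x = c"
  using assms
proof (induction n arbitrary: m x)
  case (Suc n)
  have sum: "(\<Sum>i<Suc n. a (m + i)) = a m + (\<Sum>i<n. a (Suc m + i))"
    by (subst sum.lessThan_Suc_shift) simp
  show ?case
    unfolding iterated_average.simps
  proof (rule average_cong_ball)
    fix y assume y: "\<bar>y - x\<bar> \<le> a m"
    show "iterated_average a u n (Suc m) y = c"
      by (rule Suc.IH, rule Suc.prems) (use y sum in linarith)
  qed (use a[of m] in simp)
qed simp

lemma limit_average_locally_constant:
  assumes "\<And>y. \<bar>y - x\<bar> \<le> (\<Sum>i. a (i + m)) \<Longrightarrow> u y = c"
  shows "limit_average m x = c"
proof -
  have "(\<Sum>i<n. a (m + i)) \<le> (\<Sum>i. a (i + m))" for n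
    unfolding add.commute[of m]
    using a_summable a by (intro sum_le_suminf) (auto simp: summable_iff_shift less_imp_le)
  then have "iterated_average a u n m x = c" for n
    by (intro iterated_average_locally_constant assms) (meson order_trans)
  then show ?thesis
    using limit_average_LIMSEQ[of m x] by (simp add: LIMSEQ_const_iff)
qed

end

text \<open>The cutoff is the limit of averages of a trapezoid that is 1 up to distance
  \<open>\<rho>\<close> from 0 and vanishes from \<open>2 * \<rho>\<close> on. The half-lengths add
  up to \<open>\<rho>\<close>, so the value 1 survives at 0 and the value 0 from
  \<open>3 * \<rho>\<close> on.\<close>

lemma cutoff_tower_exists:
  fixes a :: "nat \<Rightarrow> real"
  assumes a: "\<And>i. 0 < a i" and a_summable: "summable a"
  defines "\<rho> \<equiv> \<Sum>i. a i"
  obtains T :: "nat \<Rightarrow> real \<Rightarrow> real" where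
    "\<And>j x. (T j has_real_derivative T (Suc j) x) (at x)"
    "\<And>j x. \<bar>T j x\<bar> \<le> (\<Prod>i<j. 1 / a i)"
    "\<And>j. T j 0 = (if j = 0 then 1 else 0)"
    "\<And>j x. 3 * \<rho> \<le> \<bar>x\<bar> \<Longrightarrow> T j x = 0"
proof -
  have \<rho>: "0 < \<rho>"
    unfolding \<rho>_def using a a_summable by (simp add: suminf_pos)
  define u where "u x = max 0 (min 1 (2 - \<bar>x\<bar> / \<rho>))" for x
  have u_bound: "\<bar>u x\<bar> \<le> 1" for x
    by (auto simp: u_def)
  have u_lipschitz: "\<bar>u x - u y\<bar> \<le> 1 / \<rho> * \<bar>x - y\<bar>" for x y
  proof -
    have "\<bar>u x - u y\<bar> \<le> \<bar>\<bar>x\<bar> / \<rho> - \<bar>y\<bar> / \<rho>\<bar>"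
      unfolding u_def by linarith
    also have "\<dots> = \<bar>\<bar>x\<bar> - \<bar>y\<bar>\<bar> / \<rho>"
      using \<rho> by (simp add: diff_divide_distrib[symmetric])
    also have "\<dots> \<le> \<bar>x - y\<bar> / \<rho>"
      using \<rho> by (intro divide_right_mono) auto
    finally show ?thesis by simp
  qed
  have u_one: "u x = 1" if "\<bar>x\<bar> \<le> \<rho>" for x
    using that \<rho> by (simp add: u_def)
  have u_zero: "u x = 0" if "2 * \<rho> \<le> \<bar>x\<bar>" for x
    using that \<rho> by (simp add: u_def pos_le_divide_eq)
  note facts = a a_summable u_bound u_lipschitz
  define v where "v = limit_average a u"
  define R where "R m = (\<Sum>i. a (i + m))" for m
  have R: "R m = a m + R (Suc m)" for m
    using suminf_split_head[of "\<lambda>i. a (i + m)"] a_summable by (simp add: R_def summable_iff_shift)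
  have R0: "R 0 = \<rho>"
    by (simp add: R_def \<rho>_def)
  have local_const: "v m x = c" if "\<And>y. \<bar>y - x\<bar> \<le> R m \<Longrightarrow> u y = c" for m x c
    unfolding v_def by (rule limit_average_locally_constant[OF facts]) (use that in \<open>auto simp: R_def\<close>)
  show ?thesis
  proof
    show "(difference_tower a v j 0 has_real_derivative difference_tower a v (Suc j) 0 x) (at x)" for j x
      by (rule difference_tower_has_derivative)
        (use limit_average_has_derivative[OF facts] in \<open>simp add: v_def\<close>)
    show "\<bar>difference_tower a v j 0 x\<bar> \<le> (\<Prod>i<j. 1 / a i)" for j x
      using difference_tower_bound[of a v j 0 x, OF a] limit_average_bound[OF facts] by (simp add: v_def)
    show "difference_tower a v j 0 0 = (if j = 0 then 1 else 0)" for j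
      by (rule difference_tower_locally_constant[where R = R and u = u and v = v, OF local_const R a])
        (simp_all add: R0 u_one)
    show "difference_tower a v j 0 x = 0" if "3 * \<rho> \<le> \<bar>x\<bar>" for j x
    proof -
      have "difference_tower a v j 0 x = (if j = 0 then 0 else 0)"
      proof (rule difference_tower_locally_constant[where R = R and u = u and v = v, OF local_const R a])
        fix y assume "\<bar>y - x\<bar> \<le> R 0"
        then have "2 * \<rho> \<le> \<bar>y\<bar>" using that R0 by linarith
        then show "u y = 0" by (rule u_zero)
      qed
      then show ?thesis by simp
    qed
  qed
qed

section \<open>Weight functions of a nonquasianalytic sequence\<close>

text \<open>For \<open>s > 0\<close> this is the integral of
  \<open>ln (max 1 (s * t)) / t\<^sup>2\<close> over \<open>t \<ge> 1\<close>. Its derivative with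
  respect to \<open>ln s\<close> is \<open>min 1 s\<close>.\<close>

definition log_plus_int :: "real \<Rightarrow> real" where
  "log_plus_int s = min 1 s + ln (max 1 s)"

text \<open>For \<open>t > 0\<close> this is the value at \<open>t\<close> of the transform
  \<open>kappa\<close> of the function \<open>ln (1 + s\<^sup>2)\<close> of
  \<open>s\<close>.\<close>

definition log_square_int :: "real \<Rightarrow> real" where
  "log_square_int t = ln (1 + t\<^sup>2) + 2 * t * (pi / 2 - arctan t)"

text \<open>For a nonnegative integrand, \<open>nn_integral\<close> gives the existence and the
  value of the integral over the ray together.\<close>

lemma has_integral_FTC_atLeast:
  fixes f F :: "real \<Rightarrow> real"
  assumes "f \<in> borel_measurable borel"
    and "\<And>x. a \<le> x \<Longrightarrow> (F has_real_derivative f x) (at x)" and nonneg: "\<And>x. a \<le> x \<Longrightarrow> 0 \<le> f x"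
    and "(F \<longlongrightarrow> T) at_top" and "F a \<le> T"
  shows "(f has_integral (T - F a)) {a..}"
proof -
  have eq: "ennreal (f x) * indicator {a..} x = ennreal (f x * indicator {a..} x)" for x
    by (auto simp: indicator_def)
  have "(\<integral>\<^sup>+x. ennreal (f x * indicator {a..} x) \<partial>lborel) = ennreal (T - F a)"
    using nn_integral_FTC_atLeast[of f a F T] assms by (simp add: eq)
  moreover have "(\<lambda>x. f x * indicator {a..} x) \<in> borel_measurable borel"
    using assms(1) by simp
  moreover have "0 \<le> f x * indicator {a..} x" for x
    using nonneg by (auto simp: indicator_def)
  ultimately have "((\<lambda>x. f x * indicator {a..} x) has_integral (T - F a)) UNIV"
    using assms(5) by (intro nn_integral_has_integral) auto
  moreover have "(\<lambda>x. f x * indicator {a..} x) = (\<lambda>x. if x \<in> {a..} then f x else 0)"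
    by (auto simp: indicator_def)
  ultimately show ?thesis
    using has_integral_restrict_UNIV[of "{a..}" f] by simp
qed

text \<open>Where \<open>1 \<le> c * s\<close>, an antiderivative is
  \<open>- (1 + ln (c * s)) / s\<close>; below \<open>1 / c\<close> the integrand vanishes. The
  lower end \<open>a\<close> is kept general because the Poisson integral is compared on
  \<open>{r..}\<close>.\<close>

lemma log_plus_has_integral:
  assumes a: "0 < a" and c: "0 < c"
  shows "((\<lambda>s. ln (max 1 (c * s)) / s\<^sup>2) has_integral log_plus_int (c * a) / a) {a..}"
proof -
  have tail: "((\<lambda>s. ln (max 1 (c * s)) / s\<^sup>2) has_integral (1 + ln (c * b)) / b) {b..}"
    if b: "0 < b" "1 \<le> c * b" for b
  proof -
    have *: "1 \<le> c * x" "0 < x" if "b \<le> x" for x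
      using that b mult_left_mono[OF that, of c] c by linarith+
    have "((\<lambda>s. ln (c * s) / s\<^sup>2) has_integral (0 - (- (1 + ln (c * b)) / b))) {b..}"
    proof (rule has_integral_FTC_atLeast)
      fix x assume "b \<le> x"
      then show "((\<lambda>s. - (1 + ln (c * s)) / s) has_real_derivative ln (c * x) / x\<^sup>2) (at x)"
        using *[of x] c
        by (auto intro!: derivative_eq_intros simp: field_simps power2_eq_square)
      show "0 \<le> ln (c * x) / x\<^sup>2" using *[OF \<open>b \<le> x\<close>] by simp
    next
      show "((\<lambda>s. - (1 + ln (c * s)) / s) \<longlongrightarrow> 0) at_top"
        using c by real_asymp
      show "- (1 + ln (c * b)) / b \<le> 0"
        by (rule divide_nonpos_pos) (use b ln_ge_zero[OF b(2)] in linarith)+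
    qed simp
    then have "((\<lambda>s. ln (c * s) / s\<^sup>2) has_integral (1 + ln (c * b)) / b) {b..}"
      by (simp only: diff_0 minus_divide_left[symmetric] minus_minus)
    then show ?thesis
      by (rule has_integral_eq[rotated]) (use * in \<open>auto simp: max_def\<close>)
  qed
  show ?thesis
  proof (cases "1 \<le> c * a")
    case True
    then show ?thesis using tail[of a] a by (simp add: log_plus_int_def)
  next
    case False
    then have le: "a \<le> 1 / c" using c by (simp add: field_simps)
    have "((\<lambda>s. 0::real) has_integral 0) {a..1 / c}" by simp
    then have "((\<lambda>s. ln (max 1 (c * s)) / s\<^sup>2) has_integral 0) {a..1 / c}"
      by (rule has_integral_eq[rotated]) (use c in \<open>auto simp: max_def field_simps\<close>)
    moreover have "((\<lambda>s. ln (max 1 (c * s)) / s\<^sup>2) has_integral c) {1 / c..}"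
      using tail[of "1 / c"] c by simp
    moreover have "negligible ({a..1 / c} \<inter> {1 / c..})"
      by (rule negligible_subset[of "{1 / c}"]) auto
    ultimately have "((\<lambda>s. ln (max 1 (c * s)) / s\<^sup>2) has_integral (0 + c)) ({a..1 / c} \<union> {1 / c..})"
      by (rule has_integral_Un)
    moreover have "{a..1 / c} \<union> {1 / c..} = {a..}" using le by auto
    ultimately show ?thesis
      using False a by (simp add: log_plus_int_def)
  qed
qed

text \<open>Integration by parts leads to the antiderivative \<open>?F\<close>, which tends to
  \<open>c * pi\<close> at infinity.\<close>

lemma log_square_has_integral:
  assumes a: "0 < a" and c: "0 < c"
  shows "((\<lambda>s. ln (1 + (c * s)\<^sup>2) / s\<^sup>2) has_integral log_square_int (c * a) / a) {a..}"
proof -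
  let ?F = "\<lambda>s. - (ln (1 + (c * s)\<^sup>2) / s) + 2 * c * arctan (c * s)"
  have nz: "0 < 1 + (c * x)\<^sup>2" for x by (simp add: add_pos_nonneg)
  have eq: "2 * c * (pi / 2) - ?F a = log_square_int (c * a) / a"
    using a by (simp add: log_square_int_def field_simps)
  have "((\<lambda>s. ln (1 + (c * s)\<^sup>2) / s\<^sup>2) has_integral (2 * c * (pi / 2) - ?F a)) {a..}"
  proof (rule has_integral_FTC_atLeast)
    fix x assume "a \<le> x"
    then have x: "x \<noteq> 0" using a by simp
    have "((\<lambda>s. 1 + (c * s)\<^sup>2) has_real_derivative 2 * c\<^sup>2 * x) (at x)"
      by (auto intro!: derivative_eq_intros simp: power2_eq_square)
    then have ln: "((\<lambda>s. ln (1 + (c * s)\<^sup>2)) has_real_derivative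
        1 / (1 + (c * x)\<^sup>2) * (2 * c\<^sup>2 * x)) (at x)"
      by (rule DERIV_chain2[where f = ln, rotated]) (rule DERIV_ln_divide[OF nz])
    have arctan: "((\<lambda>s. 2 * c * arctan (c * s)) has_real_derivative
        2 * c * (inverse (1 + (c * x)\<^sup>2) * c)) (at x)"
      by (intro DERIV_cmult DERIV_chain2[OF DERIV_arctan]) (auto intro!: derivative_eq_intros)
    show "(?F has_real_derivative ln (1 + (c * x)\<^sup>2) / x\<^sup>2) (at x)"
      by (rule DERIV_cong[OF DERIV_add[OF DERIV_minus[OF DERIV_divide[OF ln DERIV_ident x]] arctan]])
        (use x in \<open>simp add: diff_divide_distrib power2_eq_square inverse_eq_divide\<close>)
  next
    have "((\<lambda>s. - (ln (1 + (c * s)\<^sup>2) / s)) \<longlongrightarrow> 0) at_top"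
      using c by real_asymp
    moreover have "((\<lambda>s. 2 * c * arctan (c * s)) \<longlongrightarrow> 2 * c * (pi / 2)) at_top"
      using c by (intro tendsto_intros filterlim_compose[OF tendsto_arctan_at_top]
        filterlim_tendsto_pos_mult_at_top[OF tendsto_const] filterlim_ident)
    ultimately show "(?F \<longlongrightarrow> 2 * c * (pi / 2)) at_top"
      using tendsto_add by fastforce
  next
    have "0 \<le> log_square_int (c * a) / a"
      using a c arctan_ubound[of "c * a"] by (auto simp: log_square_int_def intro!: add_nonneg_nonneg)
    then show "?F a \<le> 2 * c * (pi / 2)" using eq by linarith
  qed (use nz in auto)
  then show ?thesis unfolding eq .
qed

text \<open>For positive \<open>t\<close>, \<open>pi / 2 - arctan t = arctan (1 / t)\<close> lies
  between 0 and \<open>1 / t\<close>.\<close>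

lemma log_square_int_bounds:
  assumes "0 < t"
  shows "ln (1 + t\<^sup>2) \<le> log_square_int t" "log_square_int t \<le> ln (1 + t\<^sup>2) + 2"
proof -
  have "pi / 2 - arctan t = arctan (1 / t)"
    using arctan_inverse[of t] assms by (simp add: sgn_real_def inverse_eq_divide)
  moreover have "0 \<le> arctan (1 / t)" "arctan (1 / t) \<le> 1 / t"
    using assms by (auto simp: arctan_le_self)
  ultimately have "0 \<le> t * (pi / 2 - arctan t)" "t * (pi / 2 - arctan t) \<le> t * (1 / t)"
    using assms by (auto intro!: mult_left_mono mult_nonneg_nonneg simp del: times_divide_eq_right)
  then show "ln (1 + t\<^sup>2) \<le> log_square_int t" "log_square_int t \<le> ln (1 + t\<^sup>2) + 2"
    using assms by (auto simp: log_square_int_def)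
qed

lemma log_plus_diff_le: "\<bar>ln (max 1 x) - ln (max 1 y)\<bar> \<le> \<bar>x - y\<bar>" for x y :: real
proof -
  have *: "ln b - ln a \<le> b - a" if "1 \<le> a" "a \<le> b" for a b :: real
  proof -
    have "ln b - ln a = ln (b / a)" using that by (simp add: ln_div)
    also have "\<dots> \<le> b / a - 1" using that by (intro ln_le_minus_one) auto
    also have "\<dots> = (b - a) / a" using that by (simp add: field_simps)
    also have "\<dots> \<le> b - a" using that by (auto simp: divide_le_eq mult_le_cancel_left1)
    finally show ?thesis .
  qed
  have "\<bar>ln X - ln Y\<bar> \<le> \<bar>X - Y\<bar>" if "1 \<le> X" "1 \<le> Y" for X Y :: real
  proof (cases "X \<le> Y")
    case True
    then show ?thesis using *[of X Y] that ln_le_cancel_iff[of X Y] by simp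
  next
    case False
    then show ?thesis using *[of Y X] that ln_le_cancel_iff[of Y X] by simp
  qed
  then have "\<bar>ln (max 1 x) - ln (max 1 y)\<bar> \<le> \<bar>max 1 x - max 1 y\<bar>" by simp
  also have "\<dots> \<le> \<bar>x - y\<bar>" by linarith
  finally show ?thesis .
qed

text \<open>\<open>m i\<close> stands for the quotient with index \<open>i + 1\<close> of the weight
  sequence; dropping the leading quotient 1 turns the product up to \<open>k\<close> into one over
  \<open>i < k\<close>.\<close>

locale nonquasianalytic_weight =
  fixes m M :: "nat \<Rightarrow> real"
  assumes m_ge_1: "1 \<le> m i" and m_mono: "mono m" and m_lim: "filterlim m at_top sequentially"
    and m_summable: "summable (\<lambda>i. 1 / m i)" and M_eq: "M k = (\<Prod>i<k. m i)"
begin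

lemma m_pos [simp]: "0 < m i" using m_ge_1[of i] by linarith

lemma m_nonzero [simp]: "m i \<noteq> 0" using m_pos[of i] by linarith

lemma M_pos [simp]: "0 < M k" by (auto simp: M_eq intro: prod_pos)

lemma M_nonzero [simp]: "M k \<noteq> 0" using M_pos[of k] by linarith

lemma M_0 [simp]: "M 0 = 1" by (simp add: M_eq)

definition omega :: "real \<Rightarrow> real" where "omega t = (\<Sum>i. ln (max 1 (t / m i)))"
definition psi :: "real \<Rightarrow> real" where "psi t = (\<Sum>i. min 1 (t / m i))"
definition kappa0 :: "real \<Rightarrow> real" where "kappa0 t = (\<Sum>i. log_plus_int (t / m i))"
definition kappa1 :: "real \<Rightarrow> real" where "kappa1 t = kappa0 t + log_square_int t"

text \<open>One argument for several series: the \<open>i\<close>-th term is at most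
  \<open>\<bar>t\<bar> / m i\<close>, and the sum has Lipschitz constant
  \<open>\<Sum>i. 1 / m i\<close>. It is applied to \<open>ln (max 1 x)\<close> and
  \<open>min 1 x\<close>.\<close>

lemma
  assumes g: "\<And>x y. \<bar>g x - g y\<bar> \<le> \<bar>x - y\<bar>" and g0: "g 0 = (0::real)"
  shows lipschitz_series_summable: "summable (\<lambda>i. g (t / m i))"
    and lipschitz_series_continuous: "continuous_on S (\<lambda>t. \<Sum>i. g (t / m i))"
proof -
  have lin: "summable (\<lambda>i. \<bar>d\<bar> * (1 / m i))" for d
    by (intro summable_mult m_summable)
  have summable: "summable (\<lambda>i. g (t / m i))" for t
    by (rule summable_comparison_test'[OF lin[of t]])
      (use g[of "t / m _" 0] g0 in \<open>simp add: abs_divide abs_of_pos\<close>)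
  then show "summable (\<lambda>i. g (t / m i))" .
  have bound: "\<bar>g (x / m i) - g (y / m i)\<bar> \<le> \<bar>x - y\<bar> * (1 / m i)" for x y i
    using g[of "x / m i" "y / m i"] by (simp add: diff_divide_distrib[symmetric] abs_divide abs_of_pos)
  have "\<bar>(\<Sum>i. g (x / m i)) - (\<Sum>i. g (y / m i))\<bar> \<le> (\<Sum>i. 1 / m i) * \<bar>x - y\<bar>" for x y
  proof -
    have abs: "summable (\<lambda>i. \<bar>g (x / m i) - g (y / m i)\<bar>)"
      by (rule summable_comparison_test'[OF lin[of "x - y"]]) (use bound in auto)
    have "\<bar>(\<Sum>i. g (x / m i)) - (\<Sum>i. g (y / m i))\<bar> = \<bar>\<Sum>i. g (x / m i) - g (y / m i)\<bar>"
      by (simp add: suminf_diff summable)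
    also have "\<dots> \<le> (\<Sum>i. \<bar>g (x / m i) - g (y / m i)\<bar>)"
      by (rule summable_rabs[OF abs])
    also have "\<dots> \<le> (\<Sum>i. \<bar>x - y\<bar> * (1 / m i))"
      by (intro suminf_le bound abs lin)
    also have "\<dots> = (\<Sum>i. 1 / m i) * \<bar>x - y\<bar>"
      by (subst suminf_mult[OF m_summable]) (simp add: mult.commute)
    finally show ?thesis .
  qed
  moreover have "0 \<le> (\<Sum>i. 1 / m i)"
    by (rule suminf_nonneg[OF m_summable]) (simp add: less_imp_le)
  ultimately have "(\<Sum>i. 1 / m i)-lipschitz_on UNIV (\<lambda>t. \<Sum>i. g (t / m i))"
    by (intro lipschitz_onI) (auto simp: dist_real_def)
  then show "continuous_on S (\<lambda>t. \<Sum>i. g (t / m i))"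
    using lipschitz_on_continuous_on continuous_on_subset by blast
qed

lemma omega_summable: "summable (\<lambda>i. ln (max 1 (t / m i)))"
  using lipschitz_series_summable[of "\<lambda>x. ln (max 1 x)"] log_plus_diff_le by simp

lemma omega_continuous: "continuous_on S omega"
  using lipschitz_series_continuous[of "\<lambda>x. ln (max 1 x)"] log_plus_diff_le
  unfolding omega_def[abs_def] by simp

lemma psi_summable: "summable (\<lambda>i. min 1 (t / m i))"
  using lipschitz_series_summable[of "min 1"] by force

lemma psi_continuous: "continuous_on S psi"
  using lipschitz_series_continuous[of "min 1"] unfolding psi_def[abs_def] by force

lemma kappa0_summable: "summable (\<lambda>i. log_plus_int (t / m i))"
  unfolding log_plus_int_def by (intro summable_add psi_summable omega_summable)

lemma kappa0_eq: "kappa0 t = psi t + omega t"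
  unfolding kappa0_def psi_def omega_def log_plus_int_def
  by (rule suminf_add[symmetric, OF psi_summable omega_summable])

lemma omega_nonneg: "0 \<le> omega t"
  unfolding omega_def by (intro suminf_nonneg omega_summable) auto

lemma psi_nonneg: "0 \<le> t \<Longrightarrow> 0 \<le> psi t"
  unfolding psi_def by (intro suminf_nonneg psi_summable) (auto simp: less_imp_le)

lemma omega_mono: "0 \<le> s \<Longrightarrow> s \<le> t \<Longrightarrow> omega s \<le> omega t"
  unfolding omega_def
  by (intro suminf_le omega_summable) (auto simp: divide_right_mono less_imp_le max.coboundedI2)

lemma omega_le_kappa0: "0 \<le> t \<Longrightarrow> omega t \<le> kappa0 t"
  using psi_nonneg by (simp add: kappa0_eq)

lemma kappa0_nonneg: "0 \<le> t \<Longrightarrow> 0 \<le> kappa0 t"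
  using omega_le_kappa0[of t] omega_nonneg[of t] by linarith

lemma prod_le_exp_omega: "(\<Prod>i<k. max 1 (t / m i)) \<le> exp (omega t)"
proof -
  have "(\<Prod>i<k. max 1 (t / m i)) = exp (\<Sum>i<k. ln (max 1 (t / m i)))"
    by (simp add: exp_sum)
  also have "\<dots> \<le> exp (omega t)"
    unfolding omega_def by (simp, intro sum_le_suminf omega_summable) auto
  finally show ?thesis .
qed

lemma power_le: "0 \<le> t \<Longrightarrow> t ^ k \<le> exp (omega t) * M k"
proof -
  assume t: "0 \<le> t"
  have "t ^ k / M k = (\<Prod>i<k. t / m i)"
    by (simp add: M_eq prod_dividef)
  also have "\<dots> \<le> (\<Prod>i<k. max 1 (t / m i))"
    by (intro prod_mono) (use t in \<open>auto simp: less_imp_le\<close>)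
  also have "\<dots> \<le> exp (omega t)" by (rule prod_le_exp_omega)
  finally show ?thesis by (simp add: divide_le_eq)
qed

text \<open>By monotonicity \<open>m i \<le> t\<close> holds exactly for \<open>i < N\<close>, so
  only these factors \<open>max 1 (t / m i)\<close> differ from 1 or equal \<open>t / m i\<close>.
  Together with \<open>power_le\<close> this shows that the supremum in \<open>omega_M\<close> is a
  maximum.\<close>

lemma exp_omega_attained:
  assumes t: "0 \<le> t"
  obtains N where "exp (omega t) = t ^ N / M N"
proof -
  have "eventually (\<lambda>i. t < m i) sequentially"
    using m_lim filterlim_at_top_dense by blast
  then have ex: "\<exists>i. t < m i" by (auto simp: eventually_sequentially)
  define N where "N = (LEAST i. t < m i)"
  have N: "t < m i" if "N \<le> i" for i
    using LeastI_ex[OF ex] monoD[OF m_mono that] unfolding N_def by linarith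
  have N': "m i \<le> t" if "i < N" for i
    using not_less_Least that unfolding N_def by force
  have "omega t = (\<Sum>i<N. ln (max 1 (t / m i)))"
    unfolding omega_def
    by (rule suminf_finite) (use N in \<open>auto simp: not_less less_imp_le max_absorb1\<close>)
  then have "exp (omega t) = (\<Prod>i<N. max 1 (t / m i))"
    by (simp add: exp_sum)
  also have "\<dots> = (\<Prod>i<N. t / m i)"
    using N' by (intro prod.cong) (auto simp: max_absorb2)
  also have "\<dots> = t ^ N / M N"
    by (simp add: M_eq prod_dividef)
  finally show ?thesis using that by blast
qed

lemma omega_M_eq:
  assumes t: "0 \<le> t"
  shows "omega_M M t = omega t"
proof -
  have upper: "ln (t ^ k * M 0 / M k) \<le> omega t" for k
  proof (cases "t = 0")
    \<comment> \<open>For \<open>t = 0\<close> and positive \<open>k\<close> the term is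
      \<open>ln 0\<close>, which has the default value 0.\<close>
    case True
    then show ?thesis using omega_nonneg[of t] by (cases k) auto
  next
    case False
    then have "0 < t ^ k / M k" using t by simp
    moreover have "t ^ k / M k \<le> exp (omega t)"
      using power_le[OF t, of k] by (simp add: divide_le_eq)
    ultimately have "ln (t ^ k / M k) \<le> omega t"
      using ln_le_cancel_iff[of "t ^ k / M k" "exp (omega t)"] by simp
    then show ?thesis by simp
  qed
  obtain N where "exp (omega t) = t ^ N / M N" using exp_omega_attained[OF t] .
  then have attained: "omega t = ln (t ^ N * M 0 / M N)"
    by (metis ln_exp M_0 mult.right_neutral)
  show ?thesis
    unfolding omega_M_def using upper attained
    by (intro cSup_eq_maximum) auto
qed

lemma omega_tilde_eq: "0 \<le> t \<Longrightarrow> omega_tilde M t = omega t + ln (1 + t\<^sup>2)"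
  by (simp add: omega_tilde_def omega_M_eq)

text \<open>The summands are nonnegative, so monotone convergence allows the integrals of
  \<open>log_plus_has_integral\<close> to be added.\<close>

lemma omega_has_integral:
  assumes a: "0 < a" and c: "0 < c"
  shows "((\<lambda>s. omega (c * s) / s\<^sup>2) has_integral kappa0 (c * a) / a) {a..}"
proof -
  define f where "f N s = (\<Sum>i<N. ln (max 1 (c / m i * s)) / s\<^sup>2)" for N s
  have f: "(f N has_integral (\<Sum>i<N. log_plus_int (c * a / m i) / a)) {a..}" for N
    unfolding f_def
    by (intro has_integral_sum) (use log_plus_has_integral[of a "c / m _"] a c in auto)
  have lim: "(\<lambda>N. \<Sum>i<N. log_plus_int (c * a / m i) / a) \<longlonglongrightarrow> kappa0 (c * a) / a"
    unfolding sum_divide_distrib[symmetric] kappa0_def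
    by (intro tendsto_intros summable_LIMSEQ kappa0_summable) (use a in auto)
  have "(\<lambda>s. omega (c * s) / s\<^sup>2) integrable_on {a..}
      \<and> (\<lambda>N. integral {a..} (f N)) \<longlonglongrightarrow> integral {a..} (\<lambda>s. omega (c * s) / s\<^sup>2)"
  proof (rule monotone_convergence_increasing)
    show "f N integrable_on {a..}" for N using f by blast
    show "f N s \<le> f (Suc N) s" for N s by (simp add: f_def)
    show "(\<lambda>N. f N s) \<longlonglongrightarrow> omega (c * s) / s\<^sup>2" if "s \<in> {a..}" for s
    proof -
      have "s \<noteq> 0" using that a by auto
      then show ?thesis
        unfolding f_def sum_divide_distrib[symmetric] omega_def
        using summable_LIMSEQ[OF omega_summable[of "c * s"]] by (intro tendsto_intros) auto
    qed
    show "bounded (range (\<lambda>N. integral {a..} (f N)))"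
      using convergent_imp_bounded[OF lim] integral_unique[OF f] by simp
  qed
  moreover have "(\<lambda>N. integral {a..} (f N)) \<longlonglongrightarrow> kappa0 (c * a) / a"
    using lim integral_unique[OF f] by simp
  ultimately show ?thesis
    using LIMSEQ_unique by (metis has_integral_integral)
qed

lemma omega_tilde_has_integral:
  assumes "0 < a" and "0 < c"
  shows "((\<lambda>s. omega_tilde M (c * s) / s\<^sup>2) has_integral kappa1 (c * a) / a) {a..}"
proof -
  have "((\<lambda>s. omega (c * s) / s\<^sup>2 + ln (1 + (c * s)\<^sup>2) / s\<^sup>2) has_integral
      kappa0 (c * a) / a + log_square_int (c * a) / a) {a..}"
    by (intro has_integral_add omega_has_integral log_square_has_integral assms)
  then show ?thesis
    unfolding kappa1_def add_divide_distrib
    by (rule has_integral_eq[rotated])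
      (use assms in \<open>auto simp: omega_tilde_eq add_divide_distrib\<close>)
qed

lemma kappa_eq: "0 < t \<Longrightarrow> kappa (omega_tilde M) t = kappa1 t"
  unfolding kappa_def using omega_tilde_has_integral[of 1 t] by (simp add: integral_unique)

end

section \<open>Functions with prescribed jets\<close>

text \<open>\<open>leibniz_tower P T j p q\<close> is the \<open>j\<close>-th derivative of \<open>P p * T q\<close>, expanded without binomial
  coefficients.\<close>

fun leibniz_tower :: "(nat \<Rightarrow> real \<Rightarrow> real) \<Rightarrow> (nat \<Rightarrow> real \<Rightarrow> real) \<Rightarrow> nat \<Rightarrow> nat \<Rightarrow> nat \<Rightarrow> real \<Rightarrow> real" where
  "leibniz_tower P T 0 p q = (\<lambda>x. P p x * T q x)"
| "leibniz_tower P T (Suc j) p q =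
    (\<lambda>x. leibniz_tower P T j (Suc p) q x + leibniz_tower P T j p (Suc q) x)"

lemma leibniz_tower_has_derivative:
  assumes "\<And>j x. (P j has_real_derivative P (Suc j) x) (at x)"
    and "\<And>j x. (T j has_real_derivative T (Suc j) x) (at x)"
  shows "(leibniz_tower P T j p q has_real_derivative leibniz_tower P T (Suc j) p q x) (at x)"
proof (induction j arbitrary: p q)
  case 0
  show ?case
    using DERIV_mult'[OF assms(1)[of p x] assms(2)[of q x]] by (simp add: add.commute)
next
  case (Suc j)
  show ?case
    unfolding leibniz_tower.simps(2)[of P T j p q] leibniz_tower.simps(2)[of P T "Suc j" p q]
    by (intro DERIV_add Suc)
qed

text \<open>Each derivative raises either \<open>p\<close> or \<open>q\<close> by one, so a bound
  depending only on \<open>p + q\<close> is the same for all \<open>2 ^ j\<close> summands.\<close>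

lemma leibniz_tower_bound:
  assumes "\<And>p q. \<bar>P p x * T q x\<bar> \<le> B (p + q)"
  shows "\<bar>leibniz_tower P T j p q x\<bar> \<le> 2 ^ j * B (p + q + j)"
proof (induction j arbitrary: p q)
  case 0
  then show ?case using assms by simp
next
  case (Suc j)
  show ?case
    using Suc[of "Suc p" q] Suc[of p "Suc q"] by simp
qed

text \<open>Where \<open>T\<close> has the jet of the constant 1, only the summand with all
  derivatives on \<open>P\<close> survives.\<close>

lemma leibniz_tower_flat:
  assumes "\<And>q. T q x = (if q = 0 then 1 else 0)"
  shows "leibniz_tower P T j p q x = (if q = 0 then P (p + j) x else 0)"
  using assms by (induction j arbitrary: p q) auto

definition monomial_tower :: "nat \<Rightarrow> nat \<Rightarrow> real \<Rightarrow> real" where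
  "monomial_tower k j x = (if j \<le> k then x ^ (k - j) / fact (k - j) else 0)"

lemma monomial_tower_has_derivative:
  "(monomial_tower k j has_real_derivative monomial_tower k (Suc j) x) (at x)"
proof (cases "Suc j \<le> k")
  case True
  define n where "n = k - Suc j"
  have k: "k - j = Suc n" using True by (simp add: n_def)
  have fun_eq: "monomial_tower k j = (\<lambda>x. x ^ Suc n / fact (Suc n))"
    using True k by (auto simp: monomial_tower_def)
  have "((\<lambda>x. x ^ Suc n / fact (Suc n)) has_real_derivative real (Suc n) * x ^ n / fact (Suc n)) (at x)"
    using DERIV_cdivide[OF DERIV_pow[of "Suc n"]] by (simp del: fact_Suc of_nat_Suc power_Suc)
  also have "real (Suc n) * x ^ n / fact (Suc n) = x ^ n / fact n"
    by (simp add: field_simps del: of_nat_Suc)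
  finally show ?thesis
    unfolding fun_eq using True by (simp add: monomial_tower_def n_def)
next
  case False
  then have "monomial_tower k j = (\<lambda>x. if j = k then 1 else 0)" "monomial_tower k (Suc j) x = 0"
    by (auto simp: monomial_tower_def fun_eq_iff)
  then show ?thesis by simp
qed

lemma power_self_le_fact: "real k ^ k \<le> exp (real k) * fact k"
proof -
  have "(\<lambda>n. real k ^ n / fact n) sums exp (real k)"
    using exp_converges[of "real k"] by (simp add: divide_inverse mult.commute)
  then have "(\<Sum>n\<in>{k}. real k ^ n / fact n) \<le> exp (real k)"
    using sum_le_suminf[of "\<lambda>n. real k ^ n / fact n" "{k}"] by (auto simp: sums_iff)
  then show ?thesis by (simp add: divide_le_eq)
qed

text \<open>The range of \<open>x\<close> is the support of the cutoff. The estimate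
  \<open>fact k / fact (k - p) \<le> k ^ p\<close> restores the full power of \<open>k / r\<close>
  at the price of \<open>r ^ p\<close>, and \<open>k ^ k \<le> exp k * fact k\<close> removes the
  factorial.\<close>

lemma monomial_tower_bound:
  assumes k: "1 \<le> k" and r: "0 < r" and x: "\<bar>x\<bar> \<le> 3 * (real k / r)"
  shows "\<bar>monomial_tower k p x\<bar> \<le> (3 * exp 1 / r) ^ k * r ^ p"
proof (cases "p \<le> k")
  case True
  have "fact k div fact (k - p) \<le> k ^ p"
    using fact_div_fact_le_pow[OF True] by simp
  then have "real (fact k div fact (k - p)) \<le> real k ^ p"
    by (metis of_nat_le_iff of_nat_power)
  then have fact: "fact k / fact (k - p) \<le> real k ^ p"
    by (simp add: real_of_nat_div fact_dvd)
  have "\<bar>monomial_tower k p x\<bar> = \<bar>x\<bar> ^ (k - p) / fact (k - p)"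
    using True by (simp add: monomial_tower_def power_abs)
  also have "\<dots> \<le> (3 * (real k / r)) ^ (k - p) / fact (k - p)"
    by (intro divide_right_mono power_mono x) auto
  also have "\<dots> = 3 ^ (k - p) * (real k / r) ^ (k - p) / fact (k - p)"
    by (simp only: power_mult_distrib)
  also have "\<dots> \<le> 3 ^ k * (real k / r) ^ (k - p) / fact (k - p)"
    using r by (intro divide_right_mono mult_right_mono power_increasing) auto
  also have "\<dots> = 3 ^ k * (real k / r) ^ (k - p) * (fact k / fact (k - p)) / fact k"
    by simp
  also have "\<dots> \<le> 3 ^ k * (real k / r) ^ (k - p) * real k ^ p / fact k"
    using r fact by (intro divide_right_mono mult_left_mono) auto
  also have "\<dots> = 3 ^ k * (real k / r) ^ (k - p) * (real k / r) ^ p * r ^ p / fact k"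
    using r by (simp add: power_divide)
  also have "\<dots> = 3 ^ k * (real k / r) ^ k * r ^ p / fact k"
    using True by (simp add: mult.assoc power_add[symmetric] del: power_divide)
  also have "\<dots> = (3 / r) ^ k * r ^ p * (real k ^ k / fact k)"
    by (simp add: power_divide)
  also have "\<dots> \<le> (3 / r) ^ k * r ^ p * exp (real k)"
    using power_self_le_fact[of k] r by (intro mult_left_mono) (auto simp: divide_le_eq)
  also have "exp (real k) = exp 1 ^ k"
    by (simp add: exp_of_nat_mult[symmetric])
  finally show ?thesis by (simp add: power_mult_distrib power_divide mult_ac)
next
  case False
  then show ?thesis using r by (simp add: monomial_tower_def)
qed

section \<open>Basis functions with optimal derivative bounds\<close>

context nonquasianalytic_weight
begin

text \<open>Intermediate value theorem between \<open>psi 0 = 0\<close> and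
  \<open>psi (m n) \<ge> n\<close>; the first \<open>n\<close> summands of \<open>psi (m n)\<close>
  equal 1.\<close>

lemma psi_attains: "0 \<le> y \<Longrightarrow> \<exists>r\<ge>0. psi r = y"
proof -
  assume y: "0 \<le> y"
  obtain n where n: "y \<le> real n" using real_arch_simple by blast
  have "real n = (\<Sum>i<n. min 1 (m n / m i))"
    using monoD[OF m_mono, of _ n] by (simp add: min_absorb1)
  also have "\<dots> \<le> psi (m n)"
    unfolding psi_def by (intro sum_le_suminf psi_summable) (auto simp: less_imp_le)
  finally have "y \<le> psi (m n)" using n by simp
  moreover have "psi 0 = 0" by (simp add: psi_def)
  ultimately show ?thesis
    using IVT'[of psi 0 y "m n"] y psi_continuous by (auto simp: less_imp_le)
qed

text \<open>The tangent line at \<open>ln r\<close> of the function \<open>kappa0 \<circ> exp\<close>, which is convex with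
  derivative \<open>psi \<circ> exp\<close>.\<close>

lemma kappa0_tangent:
  assumes t: "0 < t" and r: "0 < r"
  shows "kappa0 r + psi r * ln (t / r) \<le> kappa0 t"
proof -
  \<comment> \<open>The inequality can be checked summand by summand, because \<open>t / r\<close>
    is the quotient of \<open>t / m i\<close> and \<open>r / m i\<close> for every \<open>i\<close>.
    The main tool is \<open>ln x \<le> x - 1\<close>.\<close>
  have tangent: "log_plus_int s + min 1 s * ln (u / s) \<le> log_plus_int u" if "0 < s" "0 < u" for s u
  proof -
    consider "1 \<le> s" "1 \<le> u" | "1 \<le> s" "u \<le> 1" | "s \<le> 1" "1 \<le> u" | "s \<le> 1" "u \<le> 1" by linarith
    then show ?thesis
    proof cases
      case 1
      then show ?thesis using that by (simp add: log_plus_int_def ln_div max_absorb2 min_absorb1)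
    next
      case 2
      then show ?thesis using that ln_le_minus_one[of u]
        by (simp add: log_plus_int_def ln_div max_absorb2 max_absorb1 min_absorb1 min_absorb2)
    next
      case 3
      have "s * ln (1 / s) \<le> s * (1 / s - 1)"
        using that ln_le_minus_one[of "1 / s"] by (intro mult_left_mono) auto
      moreover have "s * ln u \<le> ln u" using 3 mult_right_mono[of s 1 "ln u"] by simp
      ultimately show ?thesis using that 3
        by (simp add: log_plus_int_def ln_div max_absorb2 max_absorb1 min_absorb1 min_absorb2 algebra_simps)
    next
      case 4
      have "s * ln (u / s) \<le> s * (u / s - 1)"
        using that ln_le_minus_one[of "u / s"] by (intro mult_left_mono) auto
      then show ?thesis using that 4
        by (simp add: log_plus_int_def max_absorb1 min_absorb2 algebra_simps)
    qed
  qed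
  have "kappa0 r + psi r * ln (t / r)
      = (\<Sum>i. log_plus_int (r / m i) + min 1 (r / m i) * ln (t / r))"
    unfolding kappa0_def psi_def
    by (simp add: suminf_mult2[OF psi_summable] suminf_add kappa0_summable psi_summable summable_mult2)
  also have "\<dots> \<le> kappa0 t"
    unfolding kappa0_def
  proof (intro suminf_le kappa0_summable summable_add summable_mult2 psi_summable)
    show "log_plus_int (r / m i) + min 1 (r / m i) * ln (t / r) \<le> log_plus_int (t / m i)" for i
      using tangent[of "r / m i" "t / m i"] t r by simp
  qed
  finally show ?thesis .
qed

text \<open>Since \<open>psi r = k\<close>, the tangent line of \<open>kappa0\<close> at
  \<open>ln r\<close> has slope \<open>k\<close>, so \<open>k * ln t\<close> cancels.\<close>

lemma power_exp_kappa0_le: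
  assumes t: "0 < t" and r: "0 < r" and psi: "psi r = real k"
  shows "t ^ k * exp (- kappa0 t) \<le> r ^ k * exp (- omega r) * exp (- real k)"
proof -
  have "t ^ k * exp (- kappa0 t) = exp (real k * ln t - kappa0 t)"
    using t by (simp add: exp_diff exp_minus divide_inverse exp_of_nat_mult)
  also have "\<dots> \<le> exp (real k * ln r - omega r - real k)"
    using kappa0_tangent[OF t r] t r by (simp add: psi kappa0_eq ln_div algebra_simps)
  also have "\<dots> = r ^ k * exp (- omega r) * exp (- real k)"
    using r by (simp add: exp_diff exp_minus divide_inverse exp_of_nat_mult)
  finally show ?thesis .
qed

lemma optimal_radius_exists:
  assumes "1 \<le> k"
  obtains r where "0 < r" "psi r = real k"
proof -
  obtain r where "0 \<le> r" "psi r = real k" using psi_attains[of "real k"] by auto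
  moreover have "psi 0 = 0" by (simp add: psi_def)
  ultimately show ?thesis using that assms by (metis le_zero_eq less_eq_real_def not_one_le_zero of_nat_eq_0_iff)
qed

lemma power_exp_kappa0_bounded: "\<exists>B. \<forall>t>0. t ^ k * exp (- kappa0 t) \<le> B"
proof (cases "1 \<le> k")
  case True
  then obtain r where "0 < r" "psi r = real k" by (rule optimal_radius_exists)
  then show ?thesis using power_exp_kappa0_le by blast
next
  case False
  have "k = 0" using False by simp
  then show ?thesis using kappa0_nonneg by (intro exI[of _ 1]) auto
qed

text \<open>The last property amounts to division by the supremum of
  \<open>t ^ k * exp (- kappa0 t)\<close>; a product inequality for every \<open>t\<close> avoids
  naming that supremum.\<close>

lemma jet_basis_exists:
  assumes k: "1 \<le> k"
  obtains F :: "nat \<Rightarrow> real \<Rightarrow> real" where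
    "\<And>j x. (F j has_real_derivative F (Suc j) x) (at x)"
    "\<And>j. F j 0 = (if j = k then 1 else 0)"
    "\<And>j x t. 0 < t \<Longrightarrow> \<bar>F j x\<bar> * (t ^ k * exp (- kappa0 t)) \<le> 3 ^ k * 2 ^ j * M j"
proof -
  obtain r where r: "0 < r" "psi r = real k" using k by (rule optimal_radius_exists)
  \<comment> \<open>With these widths the cutoff has radius \<open>3 * psi r / r\<close>, and its \<open>j\<close>-th derivative is at most
    \<open>M j * exp (omega r)\<close>.\<close>
  define a where "a i = 1 / max r (m i)" for i
  have pos: "0 < max r (m i)" for i using r by simp
  have a_pos: "0 < a i" for i using pos by (simp add: a_def)
  have a_eq: "a i = min 1 (r / m i) / r" for i
    using r by (auto simp: a_def max_def min_def field_simps)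
  have a_summable: "summable a"
    unfolding a_eq[abs_def] by (intro summable_divide psi_summable)
  have a_sum: "(\<Sum>i. a i) = real k / r"
    unfolding a_eq[abs_def] using suminf_divide[OF psi_summable[of r]] r by (simp add: psi_def)
  obtain T :: "nat \<Rightarrow> real \<Rightarrow> real" where T:
    "\<And>j x. (T j has_real_derivative T (Suc j) x) (at x)"
    "\<And>j x. \<bar>T j x\<bar> \<le> (\<Prod>i<j. 1 / a i)"
    "\<And>j. T j 0 = (if j = 0 then 1 else 0)"
    "\<And>j x. 3 * (real k / r) \<le> \<bar>x\<bar> \<Longrightarrow> T j x = 0"
    by (rule cutoff_tower_exists[of a, OF a_pos a_summable, unfolded a_sum]) blast
  define B where "B n = (3 * exp 1 / r) ^ k * (\<Prod>i<n. max r (m i))" for n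
  have B_nonneg: "0 \<le> B n" for n
    unfolding B_def using r pos by (intro mult_nonneg_nonneg prod_nonneg) (auto simp: less_imp_le)
  \<comment> \<open>A derivative of the monomial costs a factor \<open>r\<close>, one of the cutoff
    a factor \<open>max r (m i)\<close>, which is at least \<open>r\<close>. Both are covered by a
    bound in \<open>p + q\<close> alone, as \<open>leibniz_tower_bound\<close> requires.\<close>
  have PT: "\<bar>monomial_tower k p x * T q x\<bar> \<le> B (p + q)" for p q x
  proof (cases "\<bar>x\<bar> \<le> 3 * (real k / r)")
    case True
    have split: "(\<Prod>i<p + q. max r (m i)) = (\<Prod>i<q. max r (m i)) * (\<Prod>i=q..<p + q. max r (m i))"
      by (subst prod.atLeastLessThan_concat[of 0 q "p + q", symmetric, unfolded atLeast0LessThan]) auto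
    have "r ^ p = (\<Prod>i=q..<p + q. r)" by simp
    also have "\<dots> \<le> (\<Prod>i=q..<p + q. max r (m i))"
      using r by (intro prod_mono) auto
    finally have "r ^ p * (\<Prod>i<q. max r (m i)) \<le> (\<Prod>i<p + q. max r (m i))"
      unfolding split using pos
      by (subst mult.commute) (auto intro!: mult_left_mono prod_nonneg simp: less_imp_le)
    note prods = this
    have "\<bar>monomial_tower k p x * T q x\<bar>
        \<le> ((3 * exp 1 / r) ^ k * r ^ p) * (\<Prod>i<q. max r (m i))"
      unfolding abs_mult using T(2)[of q x] r
      by (intro mult_mono monomial_tower_bound k True) (auto simp: a_def)
    also have "\<dots> \<le> B (p + q)"
      unfolding B_def mult.assoc using r by (intro mult_left_mono prods) auto
    finally show ?thesis .
  next
    case False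
    then show ?thesis using T(4)[of x q] B_nonneg by simp
  qed
  have B_le: "B n \<le> (3 * exp 1 / r) ^ k * (M n * exp (omega r))" for n
  proof -
    \<comment> \<open>Pulling out \<open>m i\<close> separates the weight \<open>M n\<close> from a
      product dominated by \<open>exp (omega r)\<close>.\<close>
    have "(\<Prod>i<n. max r (m i)) = (\<Prod>i<n. m i * max 1 (r / m i))"
      by (intro prod.cong refl) (auto simp: max_def field_simps)
    also have "\<dots> = M n * (\<Prod>i<n. max 1 (r / m i))"
      by (simp add: prod.distrib M_eq)
    also have "\<dots> \<le> M n * exp (omega r)"
      by (intro mult_left_mono prod_le_exp_omega) (simp add: less_imp_le)
    finally show ?thesis unfolding B_def using r by (intro mult_left_mono) auto
  qed
  show ?thesis
  proof
    let ?F = "\<lambda>j. leibniz_tower (monomial_tower k) T j 0 0"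
    show "(?F j has_real_derivative ?F (Suc j) x) (at x)" for j x
      by (intro leibniz_tower_has_derivative monomial_tower_has_derivative T(1))
    show "?F j 0 = (if j = k then 1 else 0)" for j
      using leibniz_tower_flat[of T 0 "monomial_tower k" j 0 0] T(3)
      by (auto simp: monomial_tower_def)
    show "\<bar>?F j x\<bar> * (t ^ k * exp (- kappa0 t)) \<le> 3 ^ k * 2 ^ j * M j" if t: "0 < t" for j x t
    proof -
      have "\<bar>?F j x\<bar> \<le> 2 ^ j * B (0 + 0 + j)"
        by (rule leibniz_tower_bound) (rule PT)
      also have "\<dots> \<le> 2 ^ j * ((3 * exp 1 / r) ^ k * (M j * exp (omega r)))"
        using B_le[of j] by simp
      finally have "\<bar>?F j x\<bar> * (t ^ k * exp (- kappa0 t))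
          \<le> (2 ^ j * ((3 * exp 1 / r) ^ k * (M j * exp (omega r))))
            * (r ^ k * exp (- omega r) * exp (- real k))"
        by (rule mult_mono[OF _ power_exp_kappa0_le[OF t r]])
          (use t r in \<open>simp_all add: less_imp_le\<close>)
      \<comment> \<open>The powers of \<open>r\<close> cancel here; \<open>exp 1 ^ k\<close> from
        the monomial and \<open>exp (omega r)\<close> from the cutoff meet their inverses in the
        maximum at \<open>r\<close>.\<close>
      also have "\<dots> = 3 ^ k * 2 ^ j * M j * (exp 1 ^ k * exp (- real k)) * (exp (omega r) * exp (- omega r))"
        using r by (simp add: power_divide power_mult_distrib)
      also have "\<dots> = 3 ^ k * 2 ^ j * M j"
        by (simp add: exp_of_nat_mult[symmetric] exp_minus)
      finally show ?thesis .
    qed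
  qed
qed

end

text \<open>The bound is uniform in \<open>x\<close> and geometric in \<open>k\<close>, so by the
  Weierstrass test the derivatives of each order converge uniformly and termwise differentiation is
  allowed.\<close>

lemma smooth_series:
  fixes g :: "nat \<Rightarrow> nat \<Rightarrow> real \<Rightarrow> complex"
  assumes deriv: "\<And>k j x. (g k j has_vector_derivative g k (Suc j) x) (at x)"
    and bound: "\<And>k j x. norm (g k j x) \<le> B j * (1 / 2) ^ k"
  defines "G \<equiv> \<lambda>j x. \<Sum>k. g k j x"
  shows "(G j has_vector_derivative G (Suc j) x) (at x)" and "norm (G j x) \<le> 2 * B j"
proof -
  have geometric: "summable (\<lambda>k. B j * (1 / 2) ^ k)" for j
    by (intro summable_mult summable_geometric) simp
  have summable: "summable (\<lambda>k. g k j x)" for j x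
    by (rule summable_comparison_test'[OF geometric[of j]]) (rule bound)
  have "norm (G j x) \<le> (\<Sum>k. B j * (1 / 2) ^ k)"
    unfolding G_def by (rule norm_suminf_le[OF bound geometric])
  then show "norm (G j x) \<le> 2 * B j"
    by (simp add: suminf_mult suminf_geometric)
  have unif: "uniform_limit UNIV (\<lambda>n x. \<Sum>k<n. g k (Suc j) x) (G (Suc j)) sequentially"
    unfolding G_def by (rule Weierstrass_m_test[OF bound geometric])
  have "\<exists>f. \<forall>x\<in>UNIV. (\<lambda>k. g k j x) sums f x
      \<and> (f has_derivative (\<lambda>h. h *\<^sub>R G (Suc j) x)) (at x within UNIV)"
  proof (rule has_derivative_series)
    show "(g k j has_derivative (\<lambda>h. h *\<^sub>R g k (Suc j) x)) (at x within UNIV)" for k x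
      using deriv[of k j x] by (simp add: has_vector_derivative_def)
    show "\<forall>\<^sub>F n in sequentially. \<forall>x\<in>UNIV. \<forall>h.
        norm ((\<Sum>k<n. h *\<^sub>R g k (Suc j) x) - h *\<^sub>R G (Suc j) x) \<le> e * norm h" if "0 < e" for e
      using uniform_limitD[OF unif that]
    proof eventually_elim
      case (elim n)
      show ?case
      proof (intro ballI allI)
        fix x h :: real
        have "norm ((\<Sum>k<n. h *\<^sub>R g k (Suc j) x) - h *\<^sub>R G (Suc j) x)
            = \<bar>h\<bar> * norm ((\<Sum>k<n. g k (Suc j) x) - G (Suc j) x)"
          by (simp only: scaleR_right.sum[symmetric] scaleR_right_diff_distrib[symmetric] norm_scaleR)
        also have "\<dots> \<le> \<bar>h\<bar> * e"
          using bspec[OF elim UNIV_I, of x] by (intro mult_left_mono) (auto simp: dist_norm less_imp_le)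
        finally show "norm ((\<Sum>k<n. h *\<^sub>R g k (Suc j) x) - h *\<^sub>R G (Suc j) x) \<le> e * norm h"
          by (simp add: mult.commute)
      qed
    qed
    show "(\<lambda>k. g k j 0) sums G j 0"
      unfolding G_def using summable by (rule summable_sums)
  qed auto
  then obtain f where f: "\<And>x. (\<lambda>k. g k j x) sums f x"
    "\<And>x. (f has_derivative (\<lambda>h. h *\<^sub>R G (Suc j) x)) (at x)" by auto
  have "f = G j"
    using f(1) by (auto simp: G_def sums_iff)
  then show "(G j has_vector_derivative G (Suc j) x) (at x)"
    using f(2) by (simp add: has_vector_derivative_def)
qed

section \<open>Summing the basis functions; moderate growth and the Poisson integral\<close>

context nonquasianalytic_weight
begin

text \<open>The hypothesis on \<open>K\<close> bounds \<open>K k\<close> by \<open>D\<close> times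
  the supremum of \<open>t ^ k * exp (- kappa0 t)\<close> over \<open>t \<ge> 1\<close>. This
  matches the basis bound, so the dilated basis functions can be summed with coefficients
  \<open>a k\<close>.\<close>

lemma prescribed_jet_exists:
  fixes a :: "nat \<Rightarrow> complex"
  assumes K: "\<And>k B. \<forall>t\<ge>1. t ^ k * exp (- kappa0 t) \<le> B \<Longrightarrow> K k \<le> D * B"
    and a: "\<And>k. norm (a k) \<le> A * \<sigma> ^ k * K k" and \<sigma>: "0 < \<sigma>" and A: "0 \<le> A" and D: "0 \<le> D"
  obtains G s C where
    "\<And>j x. (G j has_vector_derivative G (Suc j) x) (at x)" "\<And>j. G j 0 = a j"
    "0 < s" "\<And>j x. norm (G j x) \<le> C * (s ^ j * M j)"
proof -
  have "\<exists>F. (\<forall>j x. (F j has_real_derivative F (Suc j) x) (at x)) \<and> (\<forall>j. F j 0 = (if j = k then 1 else 0))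
      \<and> (\<forall>j x. \<bar>F j x\<bar> * K k \<le> D * (3 ^ k * 2 ^ j * M j))" for k
  proof (cases "1 \<le> k")
    case True
    then obtain F :: "nat \<Rightarrow> real \<Rightarrow> real" where F:
      "\<And>j x. (F j has_real_derivative F (Suc j) x) (at x)"
      "\<And>j. F j 0 = (if j = k then 1 else 0)"
      "\<And>j x t. 0 < t \<Longrightarrow> \<bar>F j x\<bar> * (t ^ k * exp (- kappa0 t)) \<le> 3 ^ k * 2 ^ j * M j"
      using jet_basis_exists by metis
    have "\<bar>F j x\<bar> * K k \<le> D * (3 ^ k * 2 ^ j * M j)" for j x
    proof (cases "F j x = 0")
      case True
      then show ?thesis using D by (simp add: less_imp_le)
    next
      case False
      \<comment> \<open>Division by \<open>\<bar>F j x\<bar>\<close> turns the basis estimate into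
        an upper bound to which the hypothesis on \<open>K\<close> applies.\<close>
      have "K k \<le> D * (3 ^ k * 2 ^ j * M j / \<bar>F j x\<bar>)"
        by (rule K) (use F(3)[of _ j x] False in \<open>auto simp: pos_le_divide_eq mult.commute\<close>)
      then show ?thesis using False by (simp add: field_simps)
    qed
    then show ?thesis using F(1,2) by blast
  next
    case False
    \<comment> \<open>For \<open>k = 0\<close> the constant function 1 serves as the basis
      function.\<close>
    then have k: "k = 0" by simp
    have "K k \<le> D * 1"
      using kappa0_nonneg by (intro K) (auto simp: k)
    then have "\<bar>if j = 0 then 1 else 0\<bar> * K k \<le> D * (3 ^ k * 2 ^ j * M j)" for j
      using D k by (auto simp: less_imp_le)
    then show ?thesis
      by (intro exI[of _ "\<lambda>j x. if j = 0 then 1 else 0"]) (auto simp: k)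
  qed
  then obtain F where F: "\<And>k j x. (F k j has_real_derivative F k (Suc j) x) (at x)"
      "\<And>k j. F k j 0 = (if j = k then 1 else 0)"
      "\<And>k j x. \<bar>F k j x\<bar> * K k \<le> D * (3 ^ k * 2 ^ j * M j)"
    by metis
  \<comment> \<open>Dilating the \<open>k\<close>-th basis function by \<open>l\<close> gains \<open>l powr (- k)\<close>, which beats the factor
    \<open>(3 * \<sigma>) ^ k\<close>, and costs only \<open>l ^ j\<close> in the \<open>j\<close>-th derivative.\<close>
  define l where "l = 6 * \<sigma>"
  have l: "0 < l" using \<sigma> by (simp add: l_def)
  define g where "g k j x = (l ^ j / l ^ k * F k j (l * x)) *\<^sub>R a k" for k j x
  define B where "B j = A * D * ((2 * l) ^ j * M j)" for j
  have deriv: "(g k j has_vector_derivative g k (Suc j) x) (at x)" for k j x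
  proof -
    have "((\<lambda>x. F k j (l * x)) has_real_derivative F k (Suc j) (l * x) * l) (at x)"
      by (rule DERIV_chain2[OF F(1)]) (auto intro!: derivative_eq_intros)
    then have "((\<lambda>x. l ^ j / l ^ k * F k j (l * x)) has_real_derivative
        l ^ j / l ^ k * (F k (Suc j) (l * x) * l)) (at x)"
      by (rule DERIV_cmult)
    also have "l ^ j / l ^ k * (F k (Suc j) (l * x) * l) = l ^ Suc j / l ^ k * F k (Suc j) (l * x)"
      by simp
    finally show ?thesis
      unfolding g_def[abs_def] has_real_derivative_iff_has_vector_derivative
      using bounded_linear.has_vector_derivative[OF bounded_linear_scaleR_left] by blast
  qed
  have bound: "norm (g k j x) \<le> B j * (1 / 2) ^ k" for k j x
  proof -
    have "norm (g k j x) = l ^ j / l ^ k * (\<bar>F k j (l * x)\<bar> * norm (a k))"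
      using l by (simp add: g_def abs_mult)
    also have "\<dots> \<le> l ^ j / l ^ k * (\<bar>F k j (l * x)\<bar> * (A * \<sigma> ^ k * K k))"
      using l by (intro mult_left_mono a) auto
    also have "\<dots> = l ^ j / l ^ k * (A * \<sigma> ^ k) * (\<bar>F k j (l * x)\<bar> * K k)"
      by simp
    also have "\<dots> \<le> l ^ j / l ^ k * (A * \<sigma> ^ k) * (D * (3 ^ k * 2 ^ j * M j))"
      using l \<sigma> A by (intro mult_left_mono F(3)) auto
    also have "\<dots> = B j * (\<sigma> ^ k * 3 ^ k / l ^ k)"
      by (simp add: B_def power_mult_distrib)
    also have "\<sigma> ^ k * 3 ^ k / l ^ k = (\<sigma> * 3 / l) ^ k"
      by (simp add: power_mult_distrib power_divide)
    also have "\<sigma> * 3 / l = 1 / 2"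
      using \<sigma> by (simp add: l_def)
    finally show ?thesis .
  qed
  show ?thesis
  proof
    let ?G = "\<lambda>j x. \<Sum>k. g k j x"
    show "(?G j has_vector_derivative ?G (Suc j) x) (at x)" for j x
      by (rule smooth_series(1)[where g = g and B = B, OF deriv bound])
    show "?G j 0 = a j" for j
    proof -
      have "?G j 0 = (\<Sum>k\<in>{j}. g k j 0)"
        by (rule suminf_finite) (auto simp: g_def F(2))
      then show ?thesis using l by (simp add: g_def F(2))
    qed
    show "0 < 2 * l" using l by simp
    show "norm (?G j x) \<le> 2 * A * D * ((2 * l) ^ j * M j)" for j x
      using smooth_series(2)[where g = g and B = B, OF deriv bound, of j x] by (simp add: B_def)
  qed
qed

text \<open>At an \<open>N\<close> where the maximum for \<open>t\<close> is attained, moderate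
  growth bounds the square of \<open>t ^ N / M N\<close> by the term of index \<open>N + N\<close>
  for \<open>M'\<close> at \<open>C * t\<close>.\<close>

lemma omega_M_moderate:
  assumes "nonquasianalytic_weight m' M'" and "1 \<le> C"
    and mg: "\<And>j k. M' (j + k) \<le> C ^ (j + k) * M j * M k" and t: "0 \<le> t"
  shows "2 * omega_M M t \<le> omega_M M' (C * t)"
proof -
  interpret M': nonquasianalytic_weight m' M' by fact
  obtain N where N: "exp (omega t) = t ^ N / M N" using exp_omega_attained[OF t] .
  have "exp (2 * omega t) * M' (N + N) = (t ^ N / M N) ^ 2 * M' (N + N)"
    by (simp add: N[symmetric] exp_double)
  also have "\<dots> \<le> (t ^ N / M N) ^ 2 * (C ^ (N + N) * M N * M N)"
    by (intro mult_left_mono mg) simp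
  also have "\<dots> = (C * t) ^ (N + N)"
    by (simp add: power2_eq_square power_add power_mult_distrib)
  also have "\<dots> \<le> exp (M'.omega (C * t)) * M' (N + N)"
    using assms by (intro M'.power_le) simp
  finally show ?thesis
    using assms by (simp add: omega_M_eq M'.omega_M_eq)
qed

lemma kappa_omega_M_eq: "0 < t \<Longrightarrow> kappa (omega_M M) t = kappa0 t"
proof -
  assume t: "0 < t"
  have "((\<lambda>s. omega_M M (t * s) / s\<^sup>2) has_integral kappa0 (t * 1) / 1) {1..}"
    by (rule has_integral_eq[rotated, OF omega_has_integral]) (use t in \<open>auto simp: omega_M_eq\<close>)
  then show ?thesis unfolding kappa_def by (simp add: integral_unique)
qed

lemma omega_tilde_le_kappa1:
  assumes "0 < r" shows "omega r + ln (1 + r\<^sup>2) \<le> kappa1 r"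
  using omega_le_kappa0[of r] log_square_int_bounds(1)[of r] assms by (simp add: kappa1_def)

text \<open>The integrand is even. For \<open>\<bar>t\<bar> \<ge> r\<close> its denominator lies
  between \<open>t\<^sup>2\<close> and \<open>2 * t\<^sup>2\<close>, so each tail is between
  \<open>kappa1 r / (2 * r)\<close> and \<open>kappa1 r / r\<close>. The middle part is nonnegative
  and at most \<open>2 * kappa1 r / r\<close>, because the numerator increases with
  \<open>\<bar>t\<bar>\<close> and its value at \<open>r\<close> is at most
  \<open>kappa1 r\<close>.\<close>

lemma poisson_bounds:
  assumes r: "0 < r"
  shows "kappa1 r \<le> pi * poisson (omega_tilde M) (\<i> * complex_of_real r)"
    and "pi * poisson (omega_tilde M) (\<i> * complex_of_real r) \<le> 4 * kappa1 r"
proof -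
  define w where "w t = omega \<bar>t\<bar> + ln (1 + t\<^sup>2)" for t
  define g where "g t = w t / (t\<^sup>2 + r\<^sup>2)" for t
  have w_nonneg: "0 \<le> w t" for t
    unfolding w_def by (intro add_nonneg_nonneg omega_nonneg) simp
  have denom: "0 < t\<^sup>2 + r\<^sup>2" for t
    using r by (simp add: add_nonneg_pos)
  have g_nonneg: "0 \<le> g t" for t
    unfolding g_def using w_nonneg denom by (simp add: less_imp_le)
  have poisson: "poisson (omega_tilde M) (\<i> * complex_of_real r) = r / pi * integral UNIV g"
    unfolding poisson_def g_def w_def using r
    by (simp add: omega_tilde_eq)
  have "1 + t\<^sup>2 \<noteq> 0" for t :: real
    by (metis add_pos_nonneg less_irrefl zero_le_power2 zero_less_one)
  then have g_cont: "continuous_on S g" for S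
    unfolding g_def[abs_def] w_def[abs_def] using denom
    by (intro continuous_intros continuous_on_compose2[OF omega_continuous[of UNIV]]) (auto simp: less_imp_neq[symmetric] dest: less_imp_neq)
  have tail: "((\<lambda>t. w t / t\<^sup>2) has_integral kappa1 r / r) {r..}"
  proof (rule has_integral_eq)
    show "((\<lambda>t. omega_tilde M t / t\<^sup>2) has_integral kappa1 r / r) {r..}"
      using omega_tilde_has_integral[of r 1] r by simp
  qed (use r in \<open>auto simp: w_def omega_tilde_eq\<close>)
  have g_le: "g t \<le> w t / t\<^sup>2" "w t / t\<^sup>2 / 2 \<le> g t" if "r \<le> t" for t
  proof -
    have t: "0 < t\<^sup>2" "r\<^sup>2 \<le> t\<^sup>2" using that r by (auto intro: power_mono)
    then show "g t \<le> w t / t\<^sup>2" 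
      unfolding g_def using w_nonneg[of t] by (intro divide_left_mono mult_pos_pos add_pos_nonneg) auto
    have "w t / (t\<^sup>2 * 2) \<le> g t"
      unfolding g_def using t w_nonneg[of t] by (intro divide_left_mono mult_pos_pos add_pos_nonneg) auto
    then show "w t / t\<^sup>2 / 2 \<le> g t" by simp
  qed
  have g_right: "g integrable_on {r..}"
  proof (rule measurable_bounded_by_integrable_imp_integrable)
    show "g \<in> borel_measurable (lebesgue_on {r..})"
      by (intro continuous_imp_measurable_on_sets_lebesgue g_cont) auto
    show "(\<lambda>t. w t / t\<^sup>2) integrable_on {r..}" using tail by blast
  qed (use g_le g_nonneg in auto)
  define I where "I = integral {r..} g"
  have I: "(g has_integral I) {r..}"
    unfolding I_def using g_right by (rule integrable_integral)
  have I_upper: "I \<le> kappa1 r / r"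
    by (rule has_integral_le[OF I tail]) (use g_le in auto)
  have I_lower: "kappa1 r / r / 2 \<le> I"
    by (rule has_integral_le[OF has_integral_divide[OF tail] I]) (use g_le in auto)
  have even: "(\<lambda>t. g (- t)) = g"
    by (simp add: g_def w_def fun_eq_iff)
  have "g absolutely_integrable_on {r..}"
    using g_right g_nonneg by (intro nonnegative_absolutely_integrable_1) auto
  then have "g absolutely_integrable_on {..-r} \<and> integral {..-r} g = I"
    using has_absolute_integral_reflect_real[of "{..-r}" "{r..}" g I] even by (force simp: I_def)
  then have I': "(g has_integral I) {..-r}"
    using absolutely_integrable_on_def integrable_integral by fastforce
  define J where "J = integral {-r..r} g"
  have J: "(g has_integral J) {-r..r}"
    unfolding J_def by (intro integrable_integral integrable_continuous_real g_cont)
  have "J \<le> 2 * r * (w r / r\<^sup>2)"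
  proof -
    have "g t \<le> w r / r\<^sup>2" if "t \<in> {-r..r}" for t
    proof -
      have t: "\<bar>t\<bar> \<le> r" using that by auto
      then have "t\<^sup>2 \<le> r\<^sup>2" using r by (metis abs_le_square_iff abs_of_pos)
      then have "ln (1 + t\<^sup>2) \<le> ln (1 + r\<^sup>2)"
        by (subst ln_le_cancel_iff) (auto intro: add_pos_nonneg)
      then have "w t \<le> w r"
        unfolding w_def using omega_mono[of "\<bar>t\<bar>" r] t r by simp
      then show ?thesis
        unfolding g_def using r w_nonneg[of r] by (intro frac_le) auto
    qed
    moreover have "((\<lambda>_. w r / r\<^sup>2) has_integral (r - - r) *\<^sub>R (w r / r\<^sup>2)) {-r..r}"
      using has_integral_const_real[of "w r / r\<^sup>2" "-r" r] r by (simp add: measure_def)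
    ultimately have "J \<le> (r - - r) *\<^sub>R (w r / r\<^sup>2)"
      by (intro has_integral_le[OF J]) auto
    then show ?thesis by simp
  qed
  also have "2 * r * (w r / r\<^sup>2) = 2 * w r / r"
    using r by (simp add: power2_eq_square)
  also have "\<dots> \<le> 2 * kappa1 r / r"
    using omega_tilde_le_kappa1[OF r] r by (intro divide_right_mono mult_left_mono) (auto simp: w_def)
  finally have J_upper: "J \<le> 2 * kappa1 r / r" .
  have J_lower: "0 \<le> J"
    by (rule has_integral_nonneg[OF J]) (use g_nonneg in auto)
  have "(g has_integral (I + J)) ({..-r} \<union> {-r..r})"
    by (rule has_integral_Un[OF I' J]) (rule negligible_subset[of "{-r}"], auto)
  then have "(g has_integral (I + J + I)) (({..-r} \<union> {-r..r}) \<union> {r..})"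
    by (rule has_integral_Un[OF _ I]) (rule negligible_subset[of "{r}"], use r in auto)
  moreover have "({..-r} \<union> {-r..r}) \<union> {r..} = UNIV" by auto
  ultimately have "integral UNIV g = I + J + I"
    by (simp add: integral_unique)
  then have P: "pi * poisson (omega_tilde M) (\<i> * complex_of_real r) = r * (I + J + I)"
    by (simp add: poisson)
  have "kappa1 r / r \<le> 2 * I"
    using I_lower by simp
  then have "r * (kappa1 r / r) \<le> r * (I + J + I)"
    using J_lower r by (intro mult_left_mono) auto
  then show "kappa1 r \<le> pi * poisson (omega_tilde M) (\<i> * complex_of_real r)"
    using r P by simp
  have "r * (I + J + I) \<le> r * (4 * (kappa1 r / r))"
    using I_upper J_upper r by (intro mult_left_mono) (simp_all add: field_simps)
  then show "pi * poisson (omega_tilde M) (\<i> * complex_of_real r) \<le> 4 * kappa1 r"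
    using r P by simp
qed

end

section \<open>Comparison of the two derived matrices\<close>

lemma nonquasianalytic_weight_mu_of:
  assumes "weight_seq M" and nq: "nonquasianalytic_seq M"
  shows "nonquasianalytic_weight (\<lambda>i. mu_of M (Suc i)) M"
proof -
  obtain \<mu> where \<mu>: "\<mu> 0 = 1" "mono \<mu>" "filterlim \<mu> at_top sequentially"
    "\<And>k. M k = (\<Prod>i\<le>k. \<mu> i)"
    using assms(1) unfolding weight_seq_def by blast
  have \<mu>_ge: "1 \<le> \<mu> i" for i using monoD[OF \<mu>(2), of 0 i] \<mu>(1) by simp
  have "0 < (\<Prod>i\<le>k. \<mu> i)" for k
    by (intro prod_pos) (use \<mu>_ge in \<open>auto intro: less_le_trans[OF zero_less_one]\<close>)
  then have "M k \<noteq> 0" for k using \<mu>(4)[of k] by (metis less_irrefl)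
  then have mu_of: "mu_of M (Suc i) = \<mu> (Suc i)" for i
    using \<mu>(4) by (simp add: mu_of_def)
  show ?thesis
    unfolding mu_of
  proof
    show "1 \<le> \<mu> (Suc i)" for i by (rule \<mu>_ge)
    show "mono (\<lambda>i. \<mu> (Suc i))" using \<mu>(2) by (simp add: mono_def)
    show "filterlim (\<lambda>i. \<mu> (Suc i)) at_top sequentially"
      using \<mu>(3) by (simp add: filterlim_sequentially_Suc)
    have "summable (\<lambda>i. 1 / mu_of M (Suc i))"
      using nq summable_Suc_iff[of "\<lambda>i. 1 / mu_of M i"] by (simp add: nonquasianalytic_seq_def)
    then show "summable (\<lambda>i. 1 / \<mu> (Suc i))" by (simp add: mu_of)
    show "M k = (\<Prod>i<k. \<mu> (Suc i))" for k
      by (simp add: \<mu>(1,4) prod.atMost_shift)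
  qed
qed

text \<open>With \<open>t = exp y\<close>, \<open>K_seq kn k\<close> is the supremum of
  \<open>t ^ k * exp (- \<kappa> t)\<close> over \<open>t \<ge> 1\<close> up to the factor
  \<open>exp C\<close>, so the choice of the equivalent function \<open>kn\<close> only affects
  constants.\<close>

lemma
  assumes C: "\<forall>t\<ge>0. \<bar>kn t - \<kappa> t\<bar> \<le> C"
    and bounded: "\<And>k. \<exists>B. \<forall>t\<ge>1. t ^ k * exp (- \<kappa> t) \<le> B"
  shows K_seq_lower: "1 \<le> t \<Longrightarrow> t ^ k * exp (- \<kappa> t) \<le> exp C * K_seq kn k"
    and K_seq_upper: "(\<And>t. 1 \<le> t \<Longrightarrow> t ^ k * exp (- \<kappa> t) \<le> B) \<Longrightarrow> K_seq kn k \<le> exp C * B"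
proof -
  have exp_eq: "exp (real k * y - \<kappa> (exp y)) = exp y ^ k * exp (- \<kappa> (exp y))" for y
    by (simp add: exp_diff exp_minus divide_inverse exp_of_nat_mult)
  have upper: "real k * y - kn (exp y) \<le> ln B + C"
    if B: "\<And>t. 1 \<le> t \<Longrightarrow> t ^ k * exp (- \<kappa> t) \<le> B" and y: "0 \<le> y" for B y
  proof -
    have "exp (real k * y - \<kappa> (exp y)) \<le> B"
      unfolding exp_eq using y by (intro B) simp
    then have "real k * y - \<kappa> (exp y) \<le> ln B"
      by (metis exp_gt_zero less_le_trans ln_exp ln_le_cancel_iff)
    then show ?thesis using C[rule_format, of "exp y"] by simp
  qed
  show "K_seq kn k \<le> exp C * B" if B: "\<And>t. 1 \<le> t \<Longrightarrow> t ^ k * exp (- \<kappa> t) \<le> B"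
  proof -
    have "0 < B" using B[of 1] by (simp add: less_le_trans[OF exp_gt_zero])
    moreover have "phi_star kn (real k) \<le> ln B + C"
      unfolding phi_star_def using upper[OF B] by (intro cSUP_least) auto
    ultimately show ?thesis
      by (simp add: K_seq_def exp_add mult.commute[of B] flip: exp_le_cancel_iff[of _ "ln B + C"])
  qed
  show "t ^ k * exp (- \<kappa> t) \<le> exp C * K_seq kn k" if t: "1 \<le> t"
  proof -
    obtain B where B: "\<And>t. 1 \<le> t \<Longrightarrow> t ^ k * exp (- \<kappa> t) \<le> B" using bounded[of k] by blast
    have "real k * ln t - kn (exp (ln t)) \<le> phi_star kn (real k)"
      unfolding phi_star_def
      using t by (intro cSUP_upper bdd_aboveI2[where M = "ln B + C"] upper[OF B]) auto
    then have "real k * ln t - \<kappa> (exp (ln t)) \<le> phi_star kn (real k) + C"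
      using C[rule_format, of "exp (ln t)"] by simp
    then have "exp (real k * ln t - \<kappa> (exp (ln t))) \<le> K_seq kn k * exp C"
      unfolding K_seq_def exp_add[symmetric] by simp
    then show ?thesis unfolding exp_eq using t by (simp add: mult.commute)
  qed
qed

lemma K_seq_pos: "0 < K_seq kn k"
  by (simp add: K_seq_def)

text \<open>The geometric factor \<open>c ^ k\<close> is absorbed into \<open>\<sigma>\<close>, the
  constant \<open>D\<close> into the bound.\<close>

lemma Lambda_seq_mono:
  assumes pos: "\<And>k. 0 < X k" and le: "\<And>k. X k \<le> D * c ^ k * Y k" and "0 < D" "0 < c"
  shows "Lambda_seq X \<subseteq> Lambda_seq Y"
proof
  fix a assume "a \<in> Lambda_seq X"
  then obtain \<sigma> B where \<sigma>: "0 < \<sigma>" and B: "\<And>k. norm (a k) / (\<sigma> ^ k * X k) \<le> B"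
    unfolding Lambda_seq_def by (auto simp: bdd_above_def)
  have "norm (a k) / ((c * \<sigma>) ^ k * Y k) \<le> B * D" for k
  proof -
    have Y: "0 < Y k"
      using pos[of k] le[of k] assms(3,4) less_le_trans zero_less_mult_pos by (metis mult_pos_pos zero_less_power)
    have "norm (a k) / ((c * \<sigma>) ^ k * Y k) = D * (norm (a k) / (\<sigma> ^ k * (D * c ^ k * Y k)))"
      using \<open>0 < D\<close> by (simp add: power_mult_distrib mult_ac)
    also have "\<dots> \<le> D * (norm (a k) / (\<sigma> ^ k * X k))"
      using assms(3,4) \<sigma> Y pos[of k] le[of k]
      by (intro mult_left_mono divide_left_mono mult_pos_pos) auto
    also have "\<dots> \<le> D * B"
      using \<open>0 < D\<close> by (intro mult_left_mono B) simp
    finally show ?thesis by (simp add: mult.commute)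
  qed
  then show "a \<in> Lambda_seq Y"
    unfolding Lambda_seq_def using \<sigma> \<open>0 < c\<close>
    by (intro CollectI exI[of _ "c * \<sigma>"]) (auto intro!: bdd_aboveI2)
qed

section \<open>Equality and inclusion for a weight matrix\<close>

locale nonquasianalytic_matrix_growth =
  fixes MM :: "real \<Rightarrow> nat \<Rightarrow> real" and kn :: "real \<Rightarrow> real \<Rightarrow> real"
  assumes matrix: "weight_matrix MM" and nonquasianalytic: "nonquasianalytic_matrix MM"
    and growth: "R_moderate_growth MM"
    and equivalent: "\<And>\<alpha>. 0 < \<alpha> \<Longrightarrow> \<exists>C. \<forall>t\<ge>0. \<bar>kn \<alpha> t - kappa (omega_tilde (MM \<alpha>)) t\<bar> \<le> C"
begin

lemma weight: "0 < \<alpha> \<Longrightarrow> nonquasianalytic_weight (\<lambda>i. mu_of (MM \<alpha>) (Suc i)) (MM \<alpha>)"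
  using matrix nonquasianalytic
  by (intro nonquasianalytic_weight_mu_of) (auto simp: weight_matrix_def nonquasianalytic_matrix_def)

abbreviation k0 :: "real \<Rightarrow> real \<Rightarrow> real" where "k0 \<alpha> \<equiv> kappa (omega_M (MM \<alpha>))"
abbreviation k1 :: "real \<Rightarrow> real \<Rightarrow> real" where "k1 \<alpha> \<equiv> kappa (omega_tilde (MM \<alpha>))"
abbreviation P :: "real \<Rightarrow> real \<Rightarrow> real" where
  "P \<alpha> r \<equiv> poisson (omega_tilde (MM \<alpha>)) (\<i> * complex_of_real r)"

lemma k1_eq: "0 < \<alpha> \<Longrightarrow> 0 < t \<Longrightarrow> k1 \<alpha> t = k0 \<alpha> t + log_square_int t"
  using nonquasianalytic_weight.kappa_eq[OF weight] nonquasianalytic_weight.kappa_omega_M_eq[OF weight]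
  by (simp add: nonquasianalytic_weight.kappa1_def[OF weight])

lemma k0_nonneg: "0 < \<alpha> \<Longrightarrow> 0 < t \<Longrightarrow> 0 \<le> k0 \<alpha> t"
  using nonquasianalytic_weight.kappa0_nonneg[OF weight] nonquasianalytic_weight.kappa_omega_M_eq[OF weight]
  by simp

lemma k0_le_k1: "0 < \<alpha> \<Longrightarrow> 0 < t \<Longrightarrow> k0 \<alpha> t \<le> k1 \<alpha> t"
  using k1_eq log_square_int_bounds(1)[of t] by (simp add: order_trans[rotated])

lemma power_exp_k0_bounded: "0 < \<alpha> \<Longrightarrow> \<exists>B. \<forall>t>0. t ^ k * exp (- k0 \<alpha> t) \<le> B"
  using nonquasianalytic_weight.power_exp_kappa0_bounded[OF weight] nonquasianalytic_weight.kappa_omega_M_eq[OF weight]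
  by simp

lemma power_exp_k1_bounded:
  assumes \<alpha>: "0 < \<alpha>" shows "\<exists>B. \<forall>t\<ge>1. t ^ k * exp (- k1 \<alpha> t) \<le> B"
proof -
  obtain B where B: "\<And>t. 0 < t \<Longrightarrow> t ^ k * exp (- k0 \<alpha> t) \<le> B"
    using power_exp_k0_bounded[OF \<alpha>] by blast
  have "t ^ k * exp (- k1 \<alpha> t) \<le> B" if "1 \<le> t" for t
  proof -
    have "t ^ k * exp (- k1 \<alpha> t) \<le> t ^ k * exp (- k0 \<alpha> t)"
      using that k0_le_k1[OF \<alpha>, of t] by (intro mult_left_mono) auto
    also have "\<dots> \<le> B"
      using that by (intro B) simp
    finally show ?thesis .
  qed
  then show ?thesis by blast
qed

text \<open>These are \<open>poisson_bounds\<close> after estimating \<open>pi\<close> by 4 from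
  above and by 2 from below.\<close>

lemma P_bounds:
  assumes "0 < \<alpha>" "0 < r"
  shows "k1 \<alpha> r / 8 \<le> 1 / 2 * P \<alpha> r" "1 / 2 * P \<alpha> r \<le> k1 \<alpha> r"
proof -
  have *: "k1 \<alpha> r \<le> pi * P \<alpha> r" "pi * P \<alpha> r \<le> 4 * k1 \<alpha> r"
    using nonquasianalytic_weight.poisson_bounds[OF weight] nonquasianalytic_weight.kappa_eq[OF weight] assms
    by simp_all
  have "0 \<le> k1 \<alpha> r" using k0_nonneg k0_le_k1 assms order_trans by blast
  then have P: "0 \<le> P \<alpha> r" using *(1) pi_gt_zero zero_le_mult_iff by (metis less_le_not_le order_trans)
  then have "pi * P \<alpha> r \<le> 4 * P \<alpha> r" using pi_less_4 by (intro mult_right_mono) auto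
  then show "k1 \<alpha> r / 8 \<le> 1 / 2 * P \<alpha> r" using *(1) by simp
  have "2 * P \<alpha> r \<le> pi * P \<alpha> r" using P pi_ge_two by (intro mult_right_mono) auto
  then show "1 / 2 * P \<alpha> r \<le> k1 \<alpha> r" using *(2) by simp
qed

text \<open>Each use of moderate growth gains a factor 2 at the cost of a new matrix index and a
  further dilation.\<close>

lemma omega_M_growth:
  assumes "0 < \<alpha>"
  shows "\<exists>\<beta>>0. \<exists>C\<ge>1. \<forall>t\<ge>0. 2 ^ n * omega_M (MM \<beta>) t \<le> omega_M (MM \<alpha>) (C * t)"
proof (induction n)
  case 0
  show ?case using assms by (intro exI[of _ \<alpha>] conjI exI[of _ 1]) auto
next
  case (Suc n)
  then obtain \<beta> C where \<beta>: "0 < \<beta>" "1 \<le> C"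
    "\<And>t. 0 \<le> t \<Longrightarrow> 2 ^ n * omega_M (MM \<beta>) t \<le> omega_M (MM \<alpha>) (C * t)" by blast
  obtain \<gamma> C' where \<gamma>: "0 < \<gamma>" "1 \<le> C'"
    "\<And>j k. MM \<beta> (j + k) \<le> C' ^ (j + k) * MM \<gamma> j * MM \<gamma> k"
    using growth \<beta>(1) unfolding R_moderate_growth_def by metis
  have "2 ^ Suc n * omega_M (MM \<gamma>) t \<le> omega_M (MM \<alpha>) (C * C' * t)" if t: "0 \<le> t" for t
  proof -
    have "2 * omega_M (MM \<gamma>) t \<le> omega_M (MM \<beta>) (C' * t)"
      by (rule nonquasianalytic_weight.omega_M_moderate[OF weight[OF \<gamma>(1)] weight[OF \<beta>(1)] \<gamma>(2,3) t])
    then have "2 ^ n * (2 * omega_M (MM \<gamma>) t) \<le> 2 ^ n * omega_M (MM \<beta>) (C' * t)"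
      by (intro mult_left_mono) auto
    also have "\<dots> \<le> omega_M (MM \<alpha>) (C * (C' * t))"
      using \<gamma>(2) t by (intro \<beta>(3)) auto
    finally show ?thesis by (simp add: mult_ac)
  qed
  moreover have "1 \<le> C * C'" using \<beta>(2) \<gamma>(2) mult_mono[of 1 C 1 C'] by simp
  ultimately show ?case using \<gamma>(1) by blast
qed

text \<open>The factor 16 is 8 times 2: the 8 compensates the lower bound in
  \<open>P_bounds\<close>, and two copies of \<open>k0 \<beta>\<close> remain, one to form
  \<open>K_seq\<close> and one to absorb polynomial factors.\<close>

lemma k0_growth:
  assumes \<alpha>: "0 < \<alpha>"
  obtains \<beta> C where "0 < \<beta>" "1 \<le> C" "\<And>t. 0 < t \<Longrightarrow> 16 * k0 \<beta> t \<le> k0 \<alpha> (C * t)"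
proof -
  obtain \<beta> C where \<beta>: "0 < \<beta>" "1 \<le> C"
    "\<And>t. 0 \<le> t \<Longrightarrow> 2 ^ 4 * omega_M (MM \<beta>) t \<le> omega_M (MM \<alpha>) (C * t)"
    using omega_M_growth[OF \<alpha>] by blast
  have int: "((\<lambda>s. omega_M (MM \<gamma>) (t * s) / s\<^sup>2) has_integral k0 \<gamma> t) {1..}"
    if "0 < \<gamma>" "0 < t" for \<gamma> t
  proof -
    interpret G: nonquasianalytic_weight "\<lambda>i. mu_of (MM \<gamma>) (Suc i)" "MM \<gamma>" by (rule weight) fact
    have "((\<lambda>s. G.omega (t * s) / s\<^sup>2) has_integral k0 \<gamma> t) {1..}"
      using G.omega_has_integral[of 1 t] that by (simp add: G.kappa_omega_M_eq)
    then show ?thesis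
      by (rule has_integral_eq[rotated]) (use that in \<open>auto simp: G.omega_M_eq\<close>)
  qed
  have "16 * k0 \<beta> t \<le> k0 \<alpha> (C * t)" if t: "0 < t" for t
  proof (rule has_integral_le)
    show "((\<lambda>s. 16 * (omega_M (MM \<beta>) (t * s) / s\<^sup>2)) has_integral 16 * k0 \<beta> t) {1..}"
      by (intro has_integral_mult_right int \<beta>(1) t)
    show "((\<lambda>s. omega_M (MM \<alpha>) (C * t * s) / s\<^sup>2) has_integral k0 \<alpha> (C * t)) {1..}"
      using \<beta>(2) t by (intro int \<alpha>) auto
    show "16 * (omega_M (MM \<beta>) (t * s) / s\<^sup>2) \<le> omega_M (MM \<alpha>) (C * t * s) / s\<^sup>2" if "s \<in> {1..}" for s
      using \<beta>(3)[of "t * s"] t that by (simp add: divide_right_mono mult_ac)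
  qed
  then show ?thesis using that \<beta>(1,2) by blast
qed

definition Q_fun :: "real \<Rightarrow> nat \<Rightarrow> real \<Rightarrow> real" where
  "Q_fun \<alpha> k r = r powr (real k + 1 / 2) * exp (- (1 / 2) * P \<alpha> r)"

text \<open>For \<open>r = C * t\<close> with \<open>t \<ge> 1\<close>,
  \<open>exp (- (1 / 2) * P \<alpha> r)\<close> is at most \<open>exp (- 2 * k0 \<beta> t)\<close>.
  One factor \<open>exp (- k0 \<beta> t)\<close> becomes \<open>exp (- k1 \<beta> t)\<close> at the
  cost of \<open>(1 + t\<^sup>2) * exp 2\<close>; the other absorbs this and the surplus power of
  \<open>r\<close>.\<close>

lemma Q_fun_le_K_seq:
  assumes \<alpha>: "0 < \<alpha>"
  obtains \<beta> D c where "0 < \<beta>" "0 < D" "0 < c"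
    "\<And>k r. 0 < r \<Longrightarrow> Q_fun \<alpha> k r \<le> D * c ^ k * K_seq (kn \<beta>) k"
proof -
  obtain \<beta> C where \<beta>: "0 < \<beta>" "1 \<le> C" "\<And>t. 0 < t \<Longrightarrow> 16 * k0 \<beta> t \<le> k0 \<alpha> (C * t)"
    by (rule k0_growth[OF \<alpha>]) blast
  obtain E where E: "\<forall>t\<ge>0. \<bar>kn \<beta> t - k1 \<beta> t\<bar> \<le> E" using equivalent[OF \<beta>(1)] by blast
  note K = K_seq_lower[OF E power_exp_k1_bounded[OF \<beta>(1)]]
  \<comment> \<open>The power 3 is needed for
    \<open>t * (1 + t\<^sup>2) \<le> 2 * t ^ 3\<close>.\<close>
  obtain B where B: "\<And>t. 0 < t \<Longrightarrow> t ^ 3 * exp (- k0 \<beta> t) \<le> B"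
    using power_exp_k0_bounded[OF \<beta>(1)] by blast
  have B_pos: "0 < B" using B[of 1] by (simp add: less_le_trans[OF exp_gt_zero])
  \<comment> \<open>The two summands serve the cases \<open>C \<le> r\<close> and
    \<open>r < C\<close>.\<close>
  define D where "D = C * exp E * (2 * exp 2 * B + exp (k1 \<beta> 1))"
  have D: "0 < D" unfolding D_def using \<beta>(2) B_pos by (intro mult_pos_pos add_pos_pos) auto
  have "Q_fun \<alpha> k r \<le> D * C ^ k * K_seq (kn \<beta>) k" if r: "0 < r" for k r
  proof (cases "C \<le> r")
    case True
    define t where "t = r / C"
    have t: "1 \<le> t" "r = C * t" using True \<beta>(2) by (auto simp: t_def)
    have "2 * k0 \<beta> t \<le> 1 / 2 * P \<alpha> r"
      using \<beta>(3)[of t] t P_bounds(1)[OF \<alpha> r] k0_le_k1[OF \<alpha> r] by simp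
    moreover have "k1 \<beta> t \<le> k0 \<beta> t + ln (1 + t\<^sup>2) + 2"
      using k1_eq[OF \<beta>(1), of t] log_square_int_bounds(2)[of t] t by simp
    ultimately have "- (1 / 2) * P \<alpha> r \<le> - k1 \<beta> t + (ln (1 + t\<^sup>2) + (2 + - k0 \<beta> t))"
      by simp
    then have "exp (- (1 / 2) * P \<alpha> r) \<le> exp (- k1 \<beta> t) * ((1 + t\<^sup>2) * (exp 2 * exp (- k0 \<beta> t)))"
      using add_pos_nonneg[OF zero_less_one zero_le_power2[of t]]
      unfolding exp_le_cancel_iff[symmetric, of "- (1 / 2) * P \<alpha> r"] exp_add by simp
    moreover have "r powr (real k + 1 / 2) \<le> C ^ k * t ^ k * (C * t)"
    proof -
      have "1 \<le> r" using True \<beta>(2) by simp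
      then have "r powr (real k + 1 / 2) \<le> r powr real (Suc k)"
        by (intro powr_mono) auto
      also have "\<dots> = C ^ k * t ^ k * (C * t)"
        using r by (subst powr_realpow) (auto simp: t(2) power_mult_distrib)
      finally show ?thesis .
    qed
    ultimately have "Q_fun \<alpha> k r \<le> (C ^ k * t ^ k * (C * t))
        * (exp (- k1 \<beta> t) * ((1 + t\<^sup>2) * (exp 2 * exp (- k0 \<beta> t))))"
      unfolding Q_fun_def using \<beta>(2) t by (intro mult_mono) auto
    also have "\<dots> = (t ^ k * exp (- k1 \<beta> t)) * (C * C ^ k * exp 2 * ((t * (1 + t\<^sup>2)) * exp (- k0 \<beta> t)))"
      by (simp add: mult_ac)
    also have "\<dots> \<le> (exp E * K_seq (kn \<beta>) k) * (C * C ^ k * exp 2 * (2 * B))"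
    proof (rule mult_mono[OF K[OF t(1)] mult_left_mono])
      have "t * 1 \<le> t * t\<^sup>2" using t(1) one_le_power[of t 2] by (intro mult_left_mono) auto
      then have "t * (1 + t\<^sup>2) \<le> 2 * t ^ 3" by (simp add: algebra_simps power3_eq_cube power2_eq_square)
      then have "t * (1 + t\<^sup>2) * exp (- k0 \<beta> t) \<le> 2 * t ^ 3 * exp (- k0 \<beta> t)"
        by (intro mult_right_mono) auto
      also have "\<dots> \<le> 2 * B" using B[of t] t by simp
      finally show "t * (1 + t\<^sup>2) * exp (- k0 \<beta> t) \<le> 2 * B" .
    qed (use \<beta>(2) t(1) K_seq_pos[of "kn \<beta>" k] in auto)
    also have "\<dots> = (C * exp E * (2 * exp 2 * B)) * C ^ k * K_seq (kn \<beta>) k"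
      by (simp add: mult_ac)
    also have "\<dots> \<le> D * C ^ k * K_seq (kn \<beta>) k"
      unfolding D_def using \<beta>(2) K_seq_pos[of "kn \<beta>" k]
      by (intro mult_right_mono mult_left_mono) auto
    finally show ?thesis .
  next
    \<comment> \<open>For small \<open>r\<close> the value is at most \<open>C ^ k * C\<close>, and
      \<open>K_seq (kn \<beta>) k\<close> is bounded below independently of \<open>k\<close> by its
      value at \<open>t = 1\<close>.\<close>
    case False
    have "0 \<le> k1 \<alpha> r" using k0_nonneg[OF \<alpha> r] k0_le_k1[OF \<alpha> r] by simp
    then have "exp (- (1 / 2) * P \<alpha> r) \<le> 1"
      using P_bounds(1)[OF \<alpha> r] by simp
    moreover have "r powr (real k + 1 / 2) \<le> C ^ k * C"
    proof -
      have "r powr (real k + 1 / 2) \<le> C powr (real k + 1 / 2)"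
        using False r by (intro powr_mono2) auto
      also have "\<dots> \<le> C powr real (Suc k)"
        using \<beta>(2) by (intro powr_mono) auto
      also have "\<dots> = C ^ k * C"
        using \<beta>(2) by (subst powr_realpow) auto
      finally show ?thesis .
    qed
    ultimately have "Q_fun \<alpha> k r \<le> (C ^ k * C) * 1"
      unfolding Q_fun_def using \<beta>(2) by (intro mult_mono) auto
    also have "\<dots> \<le> (C ^ k * C) * (exp (k1 \<beta> 1) * (exp E * K_seq (kn \<beta>) k))"
    proof (intro mult_left_mono)
      have "exp (- k1 \<beta> 1) \<le> exp E * K_seq (kn \<beta>) k" using K[of 1 k] by simp
      then have "exp (k1 \<beta> 1) * exp (- k1 \<beta> 1) \<le> exp (k1 \<beta> 1) * (exp E * K_seq (kn \<beta>) k)"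
        by (intro mult_left_mono) auto
      then show "1 \<le> exp (k1 \<beta> 1) * (exp E * K_seq (kn \<beta>) k)" by (simp add: exp_minus)
    qed (use \<beta>(2) in auto)
    also have "\<dots> = (C * exp E * exp (k1 \<beta> 1)) * C ^ k * K_seq (kn \<beta>) k"
      by (simp add: mult_ac)
    also have "\<dots> \<le> D * C ^ k * K_seq (kn \<beta>) k"
      unfolding D_def using \<beta>(2) K_seq_pos[of "kn \<beta>" k] B_pos
      by (intro mult_right_mono mult_left_mono) auto
    finally show ?thesis .
  qed
  then show ?thesis using that[of \<beta> D C] \<beta>(1,2) D by auto
qed

lemma Q_seq_eq: "Q_seq (MM \<alpha>) k = (SUP r\<in>{0<..}. Q_fun \<alpha> k r)"
  by (simp add: Q_seq_def Q_fun_def)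

text \<open>The estimate by \<open>K_seq\<close> also shows that the supremum in
  \<open>Q_seq\<close> is taken over a bounded set.\<close>

lemma Q_fun_le_Q_seq:
  assumes "0 < \<alpha>" "0 < r"
  shows "Q_fun \<alpha> k r \<le> Q_seq (MM \<alpha>) k"
proof -
  obtain \<beta> D c where "\<And>k r. 0 < r \<Longrightarrow> Q_fun \<alpha> k r \<le> D * c ^ k * K_seq (kn \<beta>) k"
    by (rule Q_fun_le_K_seq[OF assms(1)]) blast
  then have "bdd_above (Q_fun \<alpha> k ` {0<..})" by (intro bdd_aboveI2) auto
  then show ?thesis
    unfolding Q_seq_eq using assms(2) by (intro cSUP_upper) auto
qed

lemma Q_seq_pos:
  assumes "0 < \<alpha>" shows "0 < Q_seq (MM \<alpha>) k"
proof -
  have "0 < Q_fun \<alpha> k 1" by (simp add: Q_fun_def)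
  then show ?thesis using Q_fun_le_Q_seq[OF assms zero_less_one, of k] by linarith
qed

text \<open>From left to right the index stays the same, by the upper bound in
  \<open>P_bounds\<close> and \<open>t ^ k \<le> t powr (k + 1 / 2)\<close> for
  \<open>t \<ge> 1\<close>. The converse passes to the index \<open>\<beta>\<close> of
  \<open>Q_fun_le_K_seq\<close>.\<close>

lemma Lambda_K_eq_Q: "Lambda_fam (\<lambda>\<alpha>. K_seq (kn \<alpha>)) = Lambda_fam (\<lambda>\<alpha>. Q_seq (MM \<alpha>))"
proof (rule antisym)
  have "Lambda_seq (K_seq (kn \<alpha>)) \<subseteq> Lambda_seq (Q_seq (MM \<alpha>))" if \<alpha>: "0 < \<alpha>" for \<alpha>
  proof -
    obtain E where E: "\<forall>t\<ge>0. \<bar>kn \<alpha> t - k1 \<alpha> t\<bar> \<le> E" using equivalent[OF \<alpha>] by blast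
    have le: "t ^ k * exp (- k1 \<alpha> t) \<le> Q_seq (MM \<alpha>) k" if t: "1 \<le> t" for t k
    proof -
      have "t ^ k = t powr real k" using t by (simp add: powr_realpow)
      also have "\<dots> \<le> t powr (real k + 1 / 2)" using t by (intro powr_mono) auto
      finally have "t ^ k * exp (- k1 \<alpha> t) \<le> Q_fun \<alpha> k t"
        unfolding Q_fun_def using P_bounds(2)[OF \<alpha>, of t] t by (intro mult_mono) auto
      then show ?thesis using Q_fun_le_Q_seq[OF \<alpha>, of t k] t by simp
    qed
    show ?thesis
      by (rule Lambda_seq_mono[where D = "exp E" and c = 1])
        (use K_seq_pos K_seq_upper[OF E power_exp_k1_bounded[OF \<alpha>] le] in auto)
  qed
  then show "Lambda_fam (\<lambda>\<alpha>. K_seq (kn \<alpha>)) \<subseteq> Lambda_fam (\<lambda>\<alpha>. Q_seq (MM \<alpha>))"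
    unfolding Lambda_fam_def by blast
  have "\<exists>\<beta>>0. Lambda_seq (Q_seq (MM \<alpha>)) \<subseteq> Lambda_seq (K_seq (kn \<beta>))" if \<alpha>: "0 < \<alpha>" for \<alpha>
  proof -
    obtain \<beta> D c where \<beta>: "0 < \<beta>" "0 < D" "0 < c"
      "\<And>k r. 0 < r \<Longrightarrow> Q_fun \<alpha> k r \<le> D * c ^ k * K_seq (kn \<beta>) k"
      by (rule Q_fun_le_K_seq[OF \<alpha>]) blast
    then have "Q_seq (MM \<alpha>) k \<le> D * c ^ k * K_seq (kn \<beta>) k" for k
      unfolding Q_seq_eq by (intro cSUP_least) auto
    then show ?thesis
      using Lambda_seq_mono[of "Q_seq (MM \<alpha>)"] Q_seq_pos[OF \<alpha>] \<beta>(1-3) by blast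
  qed
  then show "Lambda_fam (\<lambda>\<alpha>. Q_seq (MM \<alpha>)) \<subseteq> Lambda_fam (\<lambda>\<alpha>. K_seq (kn \<alpha>))"
    unfolding Lambda_fam_def by blast
qed

text \<open>As \<open>k0 \<le> k1\<close>, the sequence built from \<open>omega_tilde\<close>
  satisfies the hypothesis of \<open>prescribed_jet_exists\<close> for the same index. The resulting
  bound holds on the whole line and so serves every \<open>n\<close>.\<close>

lemma Lambda_K_subset_jet_image: "Lambda_fam (\<lambda>\<alpha>. K_seq (kn \<alpha>)) \<subseteq> jet_image MM"
proof
  fix a assume "a \<in> Lambda_fam (\<lambda>\<alpha>. K_seq (kn \<alpha>))"
  then obtain \<alpha> \<sigma> A where \<alpha>: "0 < \<alpha>" and \<sigma>: "0 < \<sigma>"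
    and A: "\<And>k. norm (a k) / (\<sigma> ^ k * K_seq (kn \<alpha>) k) \<le> A"
    unfolding Lambda_fam_def Lambda_seq_def by (auto simp: bdd_above_def)
  interpret W: nonquasianalytic_weight "\<lambda>i. mu_of (MM \<alpha>) (Suc i)" "MM \<alpha>" by (rule weight) fact
  obtain E where E: "\<forall>t\<ge>0. \<bar>kn \<alpha> t - k1 \<alpha> t\<bar> \<le> E" using equivalent[OF \<alpha>] by blast
  have K: "K_seq (kn \<alpha>) k \<le> exp E * B" if B: "\<forall>t\<ge>1. t ^ k * exp (- W.kappa0 t) \<le> B" for k B
  proof (rule K_seq_upper[OF E power_exp_k1_bounded[OF \<alpha>]])
    fix t :: real assume t: "1 \<le> t"
    have "t ^ k * exp (- k1 \<alpha> t) \<le> t ^ k * exp (- W.kappa0 t)"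
      using t k0_le_k1[OF \<alpha>, of t] by (intro mult_left_mono) (auto simp: W.kappa_omega_M_eq)
    also have "\<dots> \<le> B" using B t by simp
    finally show "t ^ k * exp (- k1 \<alpha> t) \<le> B" .
  qed
  have a_bound: "norm (a k) \<le> A * \<sigma> ^ k * K_seq (kn \<alpha>) k" for k
    using A[of k] \<sigma> K_seq_pos[of "kn \<alpha>" k] by (simp add: pos_divide_le_eq mult_ac)
  have "0 \<le> norm (a 0) / (\<sigma> ^ 0 * K_seq (kn \<alpha>) 0)"
    using K_seq_pos[of "kn \<alpha>" 0] by simp
  then have "0 \<le> A" using A[of 0] by linarith
  obtain G s C where G: "\<And>j x. (G j has_vector_derivative G (Suc j) x) (at x)"
    "\<And>j. G j 0 = a j" "0 < s" "\<And>j x. norm (G j x) \<le> C * (s ^ j * MM \<alpha> j)"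
    by (rule W.prescribed_jet_exists[OF K a_bound \<sigma> \<open>0 \<le> A\<close> exp_ge_zero]) (assumption, rule that)
  have tower: "deriv_tower (G 0) G"
    unfolding deriv_tower_def using G(1) by simp
  have "norm (G k x) / (s ^ k * MM \<alpha> k) \<le> C" for k x
    using G(3) G(4)[of k x] by (simp add: pos_divide_le_eq)
  then have "bdd_above ((\<lambda>(x, k). norm (G k x) / (s ^ k * MM \<alpha> k)) ` ({- real n .. real n} \<times> UNIV))" for n
    by (intro bdd_aboveI2[where M = C]) auto
  then have "G 0 \<in> E_roumieu MM"
    unfolding E_roumieu_def using tower G(3) \<alpha>
    by (intro CollectI exI[of _ G] conjI allI exI[of _ s] exI[of _ \<alpha>])
  moreover have "a = (\<lambda>k. G k 0)" using G(2) by auto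
  ultimately show "a \<in> jet_image MM"
    unfolding jet_image_def using tower by blast
qed

end

theorem theorem3p5:
  fixes MM :: "real \<Rightarrow> nat \<Rightarrow> real" and kn :: "real \<Rightarrow> real \<Rightarrow> real"
  assumes "weight_matrix MM"
    and "nonquasianalytic_matrix MM"
    and "R_moderate_growth MM"
    and "\<forall>\<alpha>>0. (\<forall>t\<in>{0..1}. kn \<alpha> t = 0)
          \<and> (\<exists>C. \<forall>t\<ge>0. \<bar>kn \<alpha> t - kappa (omega_tilde (MM \<alpha>)) t\<bar> \<le> C)"
  shows "Lambda_fam (\<lambda>\<alpha>. K_seq (kn \<alpha>)) = Lambda_fam (\<lambda>\<alpha>. Q_seq (MM \<alpha>))
    \<and> Lambda_fam (\<lambda>\<alpha>. K_seq (kn \<alpha>)) \<subseteq> jet_image MM"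
proof -
  interpret nonquasianalytic_matrix_growth MM kn
    by unfold_locales (use assms in auto)
  show ?thesis
    using Lambda_K_eq_Q Lambda_K_subset_jet_image by blast
qed

end
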